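(* For every integer $n\ge 2$, the function $$A\mapsto \|A\|_{H^0} = \exp\left(\int_{S^{n-1}} \log |Ax| \,d\mu(x)\right)$$ is an orthogonally invariant norm on the real vector space $\mathbb R^{n\times n}$ of real $n\times n$ matrices.
   Context: Here $S^{n-1}$ is the unit sphere of $\mathbb R^n$, $\mu$ is the normalized (total mass $1$) surface measure on $S^{n-1}$, and $|\cdot|$ is the Euclidean norm on $\mathbb R^n$. The integral is finite unless $A=0$; for $A=0$ it equals $-\infty$ and $\|0\|_{H^0}=\exp(-\infty)=0$. A norm $\|\cdot\|$ on $\mathbb R^{n\times n}$ is orthogonally invariant if $\|UAV\|=\|A\|$ for all $A\in\mathbb R^{n\times n}$ and all orthogonal $n\times n$ matrices $U,V$. "Norm" means a vector space norm (no submultiplicativity is required). *)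

theory Defs
  imports "HOL-Analysis.Analysis"
begin

text \<open>
  Surface measure on the unit sphere, defined through Lebesgue measure of cones in the
  usual polar-coordinates way: the surface area of a Borel set \<open>E\<close> is the dimension times the
  volume of \<open>{t x | 0 < t \<le> 1, x \<in> E}\<close> (see \<open>emeasure_surface_measure\<close>), which is the preimage
  of \<open>E\<close> under \<open>x \<mapsto> x / |x|\<close> in the punctured closed unit ball.
\<close>

definition surface_measure :: "'a::euclidean_space measure" where
  "surface_measure =
     scale_measure (of_nat DIM('a))
       (distr (restrict_space lborel (cball 0 1 - {0})) (restrict_space borel (sphere 0 1))
          (\<lambda>x. x /\<^sub>R norm x))"

definition normalized_surface_measure :: "'a::euclidean_space measure" where
  "normalized_surface_measure =
     scale_measure (1 / emeasure surface_measure (sphere (0::'a) 1)) surface_measure"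

text \<open>
  Logarithm, integral and exponential with values in the extended reals, so that
  \<open>log 0 = -\<infinity>\<close> and \<open>exp (-\<infinity>) = 0\<close> (for the library's real \<open>ln\<close>, \<open>ln 0 = 0\<close>, and the
  Bochner integral of a non-integrable function is \<open>0\<close>).
\<close>

definition ext_ln :: "real \<Rightarrow> ereal" where
  "ext_ln x = (if x > 0 then ereal (ln x) else -\<infinity>)"

definition ext_integral :: "'a measure \<Rightarrow> ('a \<Rightarrow> ereal) \<Rightarrow> ereal" where
  "ext_integral M f =
     enn2ereal (\<integral>\<^sup>+ x. e2ennreal (f x) \<partial>M) - enn2ereal (\<integral>\<^sup>+ x. e2ennreal (- f x) \<partial>M)"

fun ext_exp :: "ereal \<Rightarrow> ereal" where
  "ext_exp (ereal r) = ereal (exp r)"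
| "ext_exp PInfty = \<infinity>"
| "ext_exp MInfty = 0"

text \<open>
  The integrand is bounded above, so the integral is never \<open>\<infinity>\<close> and \<open>real_of_ereal\<close> is harmless.
  Since \<open>real_of_ereal\<close> maps \<open>\<infinity>\<close> to \<open>0\<close>, the value is \<open>0\<close> whenever the integral is not finite;
  hence definiteness of \<open>H0_norm\<close> includes the finiteness of the integral for \<open>A \<noteq> 0\<close>.
\<close>

definition H0_norm :: "real ^ 'n ^ 'n \<Rightarrow> real" where
  "H0_norm A =
     real_of_ereal (ext_exp (ext_integral normalized_surface_measure (\<lambda>x. ext_ln (norm (A *v x)))))"

definition is_norm :: "('v::real_vector \<Rightarrow> real) \<Rightarrow> bool" where
  "is_norm N \<longleftrightarrow>
     (\<forall>v. N v \<ge> 0) \<and>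
     (\<forall>v. N v = 0 \<longleftrightarrow> v = 0) \<and>
     (\<forall>c v. N (c *\<^sub>R v) = \<bar>c\<bar> * N v) \<and>
     (\<forall>v w. N (v + w) \<le> N v + N w)"

definition orthogonally_invariant :: "(real ^ 'n ^ 'n \<Rightarrow> real) \<Rightarrow> bool" where
  "orthogonally_invariant N \<longleftrightarrow>
     (\<forall>A U V. orthogonal_matrix U \<longrightarrow> orthogonal_matrix V \<longrightarrow> N (U ** A ** V) = N A)"

lemma ext_exp_infinity [simp]: "ext_exp \<infinity> = \<infinity>" "ext_exp (-\<infinity>) = 0"
  using ext_exp.simps(2,3) by simp_all

lemma sets_surface_measure [measurable_cong]:
  "sets surface_measure = sets (restrict_space borel (sphere (0::'a::euclidean_space) 1))"
  by (simp add: surface_measure_def)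

lemma space_surface_measure: "space surface_measure = sphere (0::'a::euclidean_space) 1"
  by (simp add: surface_measure_def space_scale_measure space_restrict_space)

lemma sets_normalized_surface_measure [measurable_cong]:
  "sets normalized_surface_measure = sets (restrict_space borel (sphere (0::'a::euclidean_space) 1))"
  by (simp add: normalized_surface_measure_def sets_surface_measure)

lemma space_normalized_surface_measure:
  "space normalized_surface_measure = sphere (0::'a::euclidean_space) 1"
  by (simp add: normalized_surface_measure_def space_scale_measure space_surface_measure)

lemma measurable_radial_projection:
  "(\<lambda>x::'a::euclidean_space. x /\<^sub>R norm x)
     \<in> restrict_space lborel (cball 0 1 - {0}) \<rightarrow>\<^sub>M restrict_space borel (sphere 0 1)"
proof (rule measurable_restrict_space2)
  show "(\<lambda>x::'a. x /\<^sub>R norm x) \<in> space (restrict_space lborel (cball 0 1 - {0})) \<rightarrow> sphere 0 1"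
    by (auto simp: space_restrict_space)
  show "(\<lambda>x::'a. x /\<^sub>R norm x) \<in> borel_measurable (restrict_space lborel (cball 0 1 - {0}))"
    by (rule measurable_restrict_space1) measurable
qed

lemma radial_preimage_eq_cone:
  assumes "E \<subseteq> sphere (0::'a::real_normed_vector) 1"
  shows "(\<lambda>x. x /\<^sub>R norm x) -` E \<inter> (cball 0 1 - {0}) = {t *\<^sub>R x | t x. 0 < t \<and> t \<le> 1 \<and> x \<in> E}"
proof (intro equalityI subsetI)
  fix y assume y: "y \<in> (\<lambda>x. x /\<^sub>R norm x) -` E \<inter> (cball 0 1 - {0})"
  then have "y = norm y *\<^sub>R (y /\<^sub>R norm y)" "0 < norm y" "norm y \<le> 1" "y /\<^sub>R norm y \<in> E"
    by auto
  then show "y \<in> {t *\<^sub>R x | t x. 0 < t \<and> t \<le> 1 \<and> x \<in> E}" by blast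
next
  fix y assume "y \<in> {t *\<^sub>R x | t x. 0 < t \<and> t \<le> 1 \<and> x \<in> E}"
  then obtain t x where "y = t *\<^sub>R x" "0 < t" "t \<le> 1" "x \<in> E" by blast
  moreover from this assms have "norm x = 1" by auto
  ultimately show "y \<in> (\<lambda>x. x /\<^sub>R norm x) -` E \<inter> (cball 0 1 - {0})" by auto
qed

lemma emeasure_surface_measure:
  fixes E :: "'a::euclidean_space set"
  assumes "E \<in> sets borel" "E \<subseteq> sphere 0 1"
  shows "emeasure surface_measure E =
    of_nat DIM('a) * emeasure lborel {t *\<^sub>R x | t x. 0 < t \<and> t \<le> 1 \<and> x \<in> E}"
proof -
  have E: "E \<in> sets (restrict_space borel (sphere 0 1))"
    using assms by (auto simp: sets_restrict_space)
  have "{t *\<^sub>R x | t x. 0 < t \<and> t \<le> 1 \<and> x \<in> E} \<subseteq> cball 0 1 - {0}"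
    using radial_preimage_eq_cone[OF assms(2)] by blast
  then show ?thesis
    unfolding surface_measure_def
    by (simp add: emeasure_distr[OF measurable_radial_projection E] space_restrict_space
        emeasure_restrict_space radial_preimage_eq_cone[OF assms(2)])
qed

lemma emeasure_surface_measure_sphere:
  "0 < emeasure surface_measure (sphere (0::'a::euclidean_space) 1)"
  "emeasure surface_measure (sphere (0::'a) 1) < \<infinity>"
proof -
  have cone: "{t *\<^sub>R x | t x. 0 < t \<and> t \<le> 1 \<and> x \<in> sphere (0::'a) 1} = cball 0 1 - {0}"
    by (subst radial_preimage_eq_cone[symmetric]) auto
  have "emeasure lborel (cball (0::'a) 1 - {0}) = emeasure lborel (cball (0::'a) 1)"
    by (rule emeasure_Diff_null_set) auto
  then have eq: "emeasure surface_measure (sphere (0::'a) 1) =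
      of_nat DIM('a) * emeasure lborel (cball (0::'a) 1)"
    by (subst emeasure_surface_measure) (auto simp: cone[simplified])
  have "emeasure lborel (ball (0::'a) 1) \<le> emeasure lborel (cball (0::'a) 1)"
    by (rule emeasure_mono) auto
  moreover have "emeasure lborel (ball (0::'a) 1) \<noteq> 0"
    using open_not_negligible[of "ball (0::'a) 1"]
    by (simp add: negligible_iff_emeasure0)
  ultimately have pos: "emeasure lborel (cball (0::'a) 1) \<noteq> 0" by auto
  have fin: "emeasure lborel (cball (0::'a) 1) < \<infinity>"
    by (rule emeasure_lborel_cball_finite)
  show "0 < emeasure surface_measure (sphere (0::'a) 1)"
    using pos by (simp add: eq ennreal_zero_less_mult_iff zero_less_iff_neq_zero)
  show "emeasure surface_measure (sphere (0::'a) 1) < \<infinity>"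
    using fin by (simp add: eq ennreal_mult_less_top of_nat_less_top)
qed

lemma emeasure_normalized_surface_measure_sphere:
  "emeasure normalized_surface_measure (sphere (0::'a::euclidean_space) 1) = 1"
  using emeasure_surface_measure_sphere[where 'a='a]
  by (simp add: normalized_surface_measure_def ennreal_divide_times less_top)

lemma H0_norm_zero: "H0_norm (0 :: real ^ 'n ^ 'n) = 0"
  using emeasure_normalized_surface_measure_sphere[where 'a="real ^ 'n"]
  by (simp add: H0_norm_def ext_integral_def ext_ln_def space_normalized_surface_measure
      e2ennreal_neg zero_ennreal.rep_eq)

end

theory Submission
  imports Defs
begin

text \<open>
  Only the triangle inequality needs an idea. For a positive diagonal matrix with entries \<open>s\<close>, put
  \<open>q x = \<Sum>\<^sub>k s\<^sub>k\<^sup>2 x\<^sub>k\<^sup>2\<close> and let \<open>p\<^sub>i = s\<^sub>i\<^sup>2 x\<^sub>i\<^sup>2 / q x\<close>, random weights with sum 1. The Hessian of the norm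
  at \<open>s\<close>, up to a positive factor, is \<open>u \<mapsto> \<Sum>\<^sub>i\<^sub><\<^sub>j (2 E[p\<^sub>i p\<^sub>j] - E[p\<^sub>i] E[p\<^sub>j]) (u\<^sub>i - u\<^sub>j)\<^sup>2\<close> in the
  logarithmic directions \<open>u\<close>. Averaging over rotations of the coordinate plane \<open>(i, j)\<close> gives conditional
  expectations \<open>P\<^sub>i\<close>, \<open>P\<^sub>j\<close> for which the conditional expectation of \<open>2 p\<^sub>i p\<^sub>j\<close> is exactly \<open>P\<^sub>i P\<^sub>j\<close>; since \<open>P\<^sub>i\<close>
  and \<open>P\<^sub>j\<close> are monotone functions of the same quantity, Chebyshev's inequality makes all the coefficients
  nonnegative. So the norm is convex on positive diagonal matrices. Its supporting hyperplanes there,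
  combined with von Neumann's trace inequality, bound linear functionals of arbitrary matrices, and a
  singular value decomposition of \<open>A + B\<close> then gives the triangle inequality.
\<close>

subsection \<open>The normalized surface measure on the ambient space\<close>

text \<open>For fixed \<open>x\<close> the map \<open>s \<mapsto> norm (diag_matrix s *v x)\<close>
  is convex, but a geometric mean of convex functions need not be: the uniform measure on the
  coordinate axes would give \<open>(\<Prod>i. s $ i)\<close> to the power \<open>1 / n\<close>,
  which is concave for positive \<open>s\<close>. There all products of two different weights
  vanish. So the rotational symmetry of the sphere has to enter, and it does so exactly in the
  comparison of \<open>2 E[p\<^sub>i p\<^sub>j]\<close> with
  \<open>E[p\<^sub>i] E[p\<^sub>j]\<close>.

  In general \<open>A\<close>, \<open>B\<close> and \<open>A + B\<close> are not diagonal for one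
  common pair of orthogonal matrices, so convexity on diagonals is not applied to them directly. It
  is used in dual form, through linear functionals that split over the sum.

  Two degeneracies are met by small perturbations: the gradient needs positive singular values, and
  diagonalization by maximizing a trace needs positive, pairwise distinct weights. A third
  difficulty is the singularity of the logarithm, controlled by the measure of thin slabs around
  hyperplanes.\<close>

lemma nn_integral_lborel_translate:
  assumes [measurable]: "f \<in> borel_measurable borel"
  shows "(\<integral>\<^sup>+x. f (x + c) \<partial>lborel) = (\<integral>\<^sup>+x. f x \<partial>(lborel :: 'a::euclidean_space measure))"
proof -
  have "(\<integral>\<^sup>+x. f x \<partial>distr lborel borel ((+) c)) = (\<integral>\<^sup>+x. f (c + x) \<partial>lborel)"
    by (subst nn_integral_distr) auto
  then show ?thesis by (simp add: lborel_distr_plus add.commute)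
qed

lemma nn_integral_lborel_reflect:
  assumes [measurable]: "f \<in> borel_measurable borel"
  shows "(\<integral>\<^sup>+x. f (c - x) \<partial>lborel) = (\<integral>\<^sup>+x. f x \<partial>(lborel :: 'a::euclidean_space measure))"
proof -
  have "(\<integral>\<^sup>+x. f x \<partial>lborel) = (\<integral>\<^sup>+x. f x \<partial>distr lborel borel (\<lambda>x. c + (-1) *\<^sub>R x))"
    by (subst lborel_affine[of "-1" c]) (simp_all add: density_1)
  then show ?thesis by (subst (asm) nn_integral_distr) auto
qed

text \<open>The argument for uniqueness of Haar measure; the constant is determined by the unit ball.\<close>

lemma emeasure_lborel_orthogonal_vimage:
  fixes T :: "'a::euclidean_space \<Rightarrow> 'a"
  assumes T: "orthogonal_transformation T" and A[measurable]: "A \<in> sets borel"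
  shows "emeasure lborel (T -` A) = emeasure lborel A"
proof -
  define B where "B = cball (0::'a) 1"
  have lin: "linear T" using T by (rule orthogonal_transformation_linear)
  then have [measurable]: "T \<in> borel_measurable borel"
    by (intro borel_measurable_continuous_onI linear_continuous_on) (simp add: linear_linear)
  have [measurable]: "B \<in> sets borel" by (simp add: B_def)
  have vimage_B: "T -` B = B"
    using orthogonal_transformation_norm[OF T] by (auto simp: B_def)
  have ind: "emeasure lborel (T -` S) = (\<integral>\<^sup>+x. indicator S (T x) \<partial>lborel)"
    if [measurable]: "S \<in> sets borel" for S
  proof -
    have "T -` S \<in> sets lborel"
      using measurable_sets[of T borel borel S] that by simp
    then have "emeasure lborel (T -` S) = (\<integral>\<^sup>+x. indicator (T -` S) x \<partial>lborel)"
      by (rule nn_integral_indicator[symmetric])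
    then show ?thesis by (simp add: indicator_def)
  qed
  let ?i = "indicator :: 'a set \<Rightarrow> 'a \<Rightarrow> ennreal"
  have "emeasure lborel (T -` A) * emeasure lborel B
      = (\<integral>\<^sup>+x. \<integral>\<^sup>+y. ?i A (T x) * ?i B y \<partial>lborel \<partial>lborel)"
    by (simp add: ind nn_integral_cmult nn_integral_multc)
  also have "\<dots> = (\<integral>\<^sup>+x. \<integral>\<^sup>+y. ?i A (T x) * ?i B (y + T x) \<partial>lborel \<partial>lborel)"
    by (rule nn_integral_cong, rule nn_integral_lborel_translate[symmetric]) measurable
  also have "\<dots> = (\<integral>\<^sup>+y. \<integral>\<^sup>+x. ?i A (T x) * ?i B (y + T x) \<partial>lborel \<partial>lborel)"
    by (rule lborel_pair.Fubini'[symmetric]) measurable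
  \<comment> \<open>With \<open>T z = y\<close>, translating \<open>x\<close> by \<open>z\<close>
    moves \<open>y\<close> from the argument of \<open>B\<close> to that of \<open>A\<close>.
    Reflecting \<open>y\<close> afterwards frees \<open>A\<close> from \<open>T\<close>, which then
    survives only at the invariant ball.\<close>
  also have "\<dots> = (\<integral>\<^sup>+y. \<integral>\<^sup>+x. ?i A (T x - y) * ?i B (T x) \<partial>lborel \<partial>lborel)"
  proof (rule nn_integral_cong)
    fix y
    obtain z where z: "T z = y"
      using orthogonal_transformation_surj[OF T] by (metis surjD)
    have "(\<integral>\<^sup>+x. ?i A (T x - y) * ?i B (T x) \<partial>lborel)
        = (\<integral>\<^sup>+x. ?i A (T (x + z) - y) * ?i B (T (x + z)) \<partial>lborel)"
      by (rule nn_integral_lborel_translate[symmetric]) measurable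
    then show "(\<integral>\<^sup>+x. ?i A (T x) * ?i B (y + T x) \<partial>lborel)
        = (\<integral>\<^sup>+x. ?i A (T x - y) * ?i B (T x) \<partial>lborel)"
      by (simp add: linear_add[OF lin] z add.commute)
  qed
  also have "\<dots> = (\<integral>\<^sup>+x. \<integral>\<^sup>+y. ?i A (T x - y) * ?i B (T x) \<partial>lborel \<partial>lborel)"
    by (rule lborel_pair.Fubini') measurable
  also have "\<dots> = (\<integral>\<^sup>+x. \<integral>\<^sup>+y. ?i A y * ?i B (T x) \<partial>lborel \<partial>lborel)"
    by (rule nn_integral_cong, rule nn_integral_lborel_reflect) measurable
  also have "\<dots> = emeasure lborel A * emeasure lborel B"
    by (simp add: nn_integral_cmult nn_integral_multc flip: ind) (simp add: vimage_B)
  finally have eq: "emeasure lborel (T -` A) * emeasure lborel B = emeasure lborel A * emeasure lborel B" .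
  have "emeasure lborel B \<noteq> 0"
  proof -
    have "emeasure lborel (ball (0::'a) 1) \<noteq> 0"
      using open_not_negligible[of "ball (0::'a) 1"] by (simp add: negligible_iff_emeasure0)
    moreover have "emeasure lborel (ball (0::'a) 1) \<le> emeasure lborel B"
      by (rule emeasure_mono) (auto simp: B_def)
    ultimately show ?thesis by auto
  qed
  moreover have "emeasure lborel B \<noteq> \<infinity>"
    using emeasure_lborel_cball_finite[of "0::'a" 1] by (simp add: B_def)
  ultimately show ?thesis
    using eq by (metis ennreal_mult_divide_eq infinity_ennreal_def)
qed

text \<open>Pushed forward to the whole space, so that Borel measurable functions and linear maps
  apply without restriction to the sphere; \<open>norm x = 1\<close> becomes an almost-everywhere
  statement.\<close>

definition sphere_prob :: "'a::euclidean_space measure" where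
  "sphere_prob = distr normalized_surface_measure borel (\<lambda>x. x)"

lemma sets_sphere_prob [simp]: "sets sphere_prob = sets borel"
  and space_sphere_prob [simp]: "space sphere_prob = UNIV"
  by (simp_all add: sphere_prob_def)

lemma borel_measurable_sphere_prob:
  "f \<in> borel_measurable borel \<Longrightarrow> f \<in> borel_measurable sphere_prob"
  by (simp cong: measurable_cong_sets)

lemma measurable_id_normalized_surface_measure [measurable]:
  "(\<lambda>x. x) \<in> normalized_surface_measure \<rightarrow>\<^sub>M borel"
  by (subst measurable_cong_sets[OF sets_normalized_surface_measure refl])
    (rule measurable_restrict_space1, simp)

lemma emeasure_sphere_prob:
  fixes E :: "'a::euclidean_space set"
  assumes [measurable]: "E \<in> sets borel"
  shows "emeasure sphere_prob E = of_nat DIM('a) / emeasure surface_measure (sphere (0::'a) 1) *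
    emeasure lborel ((\<lambda>x. x /\<^sub>R norm x) -` E \<inter> (cball 0 1 - {0}))"
proof -
  let ?S = "sphere (0::'a) 1"
  have "emeasure sphere_prob E = emeasure normalized_surface_measure (E \<inter> ?S)"
    unfolding sphere_prob_def
    by (subst emeasure_distr) (auto simp: space_normalized_surface_measure)
  also have "\<dots> = 1 / emeasure surface_measure ?S * emeasure surface_measure (E \<inter> ?S)"
    by (simp add: normalized_surface_measure_def)
  also have "emeasure surface_measure (E \<inter> ?S) = of_nat DIM('a) *
      emeasure lborel ((\<lambda>x. x /\<^sub>R norm x) -` (E \<inter> ?S) \<inter> (cball 0 1 - {0}))"
    by (subst radial_preimage_eq_cone) (rule Int_lower2, rule emeasure_surface_measure, auto)
  also have "(\<lambda>x. x /\<^sub>R norm x) -` (E \<inter> ?S) \<inter> (cball 0 1 - {0}) =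
      (\<lambda>x. x /\<^sub>R norm x) -` E \<inter> (cball 0 1 - {0})" by auto
  finally show ?thesis
    by (simp add: divide_ennreal_def mult_ac)
qed

lemma AE_sphere_prob_norm: "AE x in sphere_prob. norm x = 1"
  unfolding sphere_prob_def
  by (subst AE_distr_iff) (auto simp: space_normalized_surface_measure)

lemma emeasure_sphere_prob_UNIV: "emeasure (sphere_prob :: 'a::euclidean_space measure) UNIV = 1"
  unfolding sphere_prob_def
  by (subst emeasure_distr)
    (auto simp: space_normalized_surface_measure emeasure_normalized_surface_measure_sphere)

lemma finite_measure_sphere_prob: "finite_measure (sphere_prob :: 'a::euclidean_space measure)"
  by (rule finite_measureI) (simp add: emeasure_sphere_prob_UNIV)

lemma measure_sphere_prob_UNIV [simp]: "measure (sphere_prob :: 'a::euclidean_space measure) UNIV = 1"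
  by (simp add: measure_def emeasure_sphere_prob_UNIV)

text \<open>An orthogonal map commutes with the radial projection and preserves the punctured ball,
  so invariance is inherited from Lebesgue measure.\<close>

lemma distr_sphere_prob_orthogonal:
  fixes T :: "'a::euclidean_space \<Rightarrow> 'a"
  assumes T: "orthogonal_transformation T"
  shows "distr sphere_prob borel T = sphere_prob"
proof (rule measure_eqI)
  have lin: "linear T" using T by (rule orthogonal_transformation_linear)
  then have [measurable]: "T \<in> borel_measurable borel"
    by (intro borel_measurable_continuous_onI linear_continuous_on) (simp add: linear_linear)
  fix E assume "E \<in> sets (distr sphere_prob borel T)"
  then have [measurable]: "E \<in> sets borel" by simp
  let ?C = "\<lambda>E. (\<lambda>x. x /\<^sub>R norm x) -` E \<inter> (cball (0::'a) 1 - {0})"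
  have "T -` E \<in> sets borel" using measurable_sets[of T borel borel E] by simp
  then have [measurable]: "(T -` E) \<in> sets borel" .
  have "T x = 0 \<longleftrightarrow> x = 0" for x
    using orthogonal_transformation_norm[OF T, of x] by (metis norm_eq_zero)
  then have C: "?C (T -` E) = T -` ?C E"
    by (simp add: set_eq_iff orthogonal_transformation_norm[OF T] flip: linear_scale[OF lin])
  have [measurable]: "?C E \<in> sets borel"
  proof -
    have "(\<lambda>x::'a. x /\<^sub>R norm x) -` E \<in> sets borel"
      using measurable_sets[of "\<lambda>x::'a. x /\<^sub>R norm x" borel borel E] by simp
    then show ?thesis by measurable
  qed
  have "emeasure (distr sphere_prob borel T) E = emeasure sphere_prob (T -` E)"
    by (subst emeasure_distr) (auto cong: measurable_cong_sets)
  also have "\<dots> = emeasure sphere_prob E"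
    unfolding emeasure_sphere_prob[OF \<open>E \<in> sets borel\<close>] emeasure_sphere_prob[OF \<open>T -` E \<in> sets borel\<close>] C
    by (simp only: emeasure_lborel_orthogonal_vimage[OF T \<open>?C E \<in> sets borel\<close>])
  finally show "emeasure (distr sphere_prob borel T) E = emeasure sphere_prob E" .
qed simp

text \<open>The cone over the slab lies in a box of half-width \<open>e\<close> in direction
  \<open>k\<close> and \<open>1\<close> in the others, of volume \<open>2 ^ CARD('n) * e\<close>.
  Linear decay in \<open>e\<close> is enough for integrability of the logarithm, and
  \<open>e = 0\<close> shows that the hyperplane is null.\<close>

lemma emeasure_sphere_prob_slab:
  fixes k :: "'n::finite"
  obtains C where "\<And>e. 0 \<le> e \<Longrightarrow> emeasure (sphere_prob :: (real^'n) measure) {x. \<bar>x $ k\<bar> \<le> e} \<le> ennreal (C * e)"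
proof -
  let ?c = "of_nat DIM(real^'n) / emeasure surface_measure (sphere (0::real^'n) 1)"
  obtain c where c: "0 \<le> c" "?c = ennreal c"
  proof -
    have "?c < \<infinity>"
      using emeasure_surface_measure_sphere[where 'a="real^'n"]
      by (auto simp: ennreal_divide_eq_top_iff less_top[symmetric])
    then show ?thesis using that by (cases ?c) auto
  qed
  have "emeasure (sphere_prob :: (real^'n) measure) {x. \<bar>x $ k\<bar> \<le> e} \<le> ennreal (c * 2 ^ CARD('n) * e)"
    if e: "0 \<le> e" for e
  proof -
    let ?u = "(\<chi> i. if i = k then e else 1) :: real^'n"
    have "(\<lambda>x. x /\<^sub>R norm x) -` {x. \<bar>x $ k\<bar> \<le> e} \<inter> (cball 0 1 - {0}) \<subseteq> cbox (- ?u) ?u"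
    proof (rule subsetI, unfold mem_box_cart, intro allI)
      fix x :: "real^'n" and i
      assume "x \<in> (\<lambda>x. x /\<^sub>R norm x) -` {x. \<bar>x $ k\<bar> \<le> e} \<inter> (cball 0 1 - {0})"
      then have x: "\<bar>(x /\<^sub>R norm x) $ k\<bar> \<le> e" "x \<in> cball 0 1" "x \<noteq> 0" by auto
      then have n: "norm x \<le> 1" "norm x > 0" by auto
      have "\<bar>x $ k\<bar> = norm x * \<bar>(x /\<^sub>R norm x) $ k\<bar>" using n by (simp add: abs_mult)
      also have "\<dots> \<le> 1 * e" by (intro mult_mono) (use x n e in auto)
      finally have "\<bar>x $ k\<bar> \<le> e" by simp
      moreover have "\<bar>x $ i\<bar> \<le> 1" using component_le_norm_cart[of x i] n by linarith
      ultimately show "(- ?u) $ i \<le> x $ i \<and> x $ i \<le> ?u $ i" by auto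
    qed
    then have "emeasure lborel ((\<lambda>x. x /\<^sub>R norm x) -` {x. \<bar>x $ k\<bar> \<le> e} \<inter> (cball 0 1 - {0}))
        \<le> emeasure lborel (cbox (- ?u) ?u)" by (rule emeasure_mono) simp
    also have "\<dots> = ennreal (measure lborel (cbox (- ?u) ?u))"
      using emeasure_lborel_cbox_finite[of "- ?u" ?u]
      by (intro emeasure_eq_ennreal_measure) (simp add: less_top)
    also have "measure lborel (cbox (- ?u) ?u) = (\<Prod>i\<in>UNIV. 2 * ?u $ i)"
      using e by (subst content_cbox_cart) (auto simp: interval_eq_empty_cart)
    also have "\<dots> = 2 ^ CARD('n) * e"
      by (simp add: prod.distrib prod.delta)
    finally have "emeasure (sphere_prob :: (real^'n) measure) {x. \<bar>x $ k\<bar> \<le> e}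
        \<le> ennreal c * ennreal (2 ^ CARD('n) * e)"
      by (subst emeasure_sphere_prob, measurable) (auto simp only: c(2) zero_le intro!: mult_left_mono)
    then show ?thesis using e c by (simp add: ennreal_mult mult_ac)
  qed
  then show ?thesis by (rule that)
qed

subsection \<open>Integrability of the logarithm\<close>

lemma integrable_sphere_prob_coord:
  fixes k :: "'n::finite"
  shows "AE x in (sphere_prob :: (real^'n) measure). x $ k \<noteq> 0"
    and "integrable sphere_prob (\<lambda>x::real^'n. ln \<bar>x $ k\<bar>)"
proof -
  let ?M = "sphere_prob :: (real^'n) measure"
  let ?B = "\<lambda>m::nat. {x::real^'n. \<bar>x $ k\<bar> \<le> (1/2)^m}"
  obtain C where C: "\<And>e. 0 \<le> e \<Longrightarrow> emeasure ?M {x. \<bar>x $ k\<bar> \<le> e} \<le> ennreal (C * e)"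
    using emeasure_sphere_prob_slab[of k] by metis
  have "emeasure ?M {x. \<bar>x $ k\<bar> \<le> 0} = 0" using C[of 0] by simp
  then show nz: "AE x in ?M. x $ k \<noteq> 0"
    by (subst AE_iff_measurable[OF _ refl]) auto
  \<comment> \<open>Dyadic layer count: \<open>y\<close> lies in the slabs
    \<open>m = 0, ..., N\<close>, where \<open>N\<close> is the integer part of
    \<open>- ln \<bar>y\<bar> / ln 2\<close>, and these \<open>N + 1\<close> terms,
    \<open>m = 0\<close> included, bound the logarithm. The measures of the slabs are bounded by a
    geometric series.\<close>
  have bound: "ennreal \<bar>ln \<bar>y\<bar>\<bar> \<le> (\<Sum>m. ennreal (ln 2) * indicator {x. \<bar>x\<bar> \<le> (1/2)^m} y)"
    if y: "y \<noteq> 0" "\<bar>y\<bar> \<le> 1" for y :: real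
  proof -
    define N where "N = nat \<lfloor>- ln \<bar>y\<bar> / ln 2\<rfloor>"
    have nonneg: "- ln \<bar>y\<bar> / ln 2 \<ge> 0" using y by (simp add: divide_nonpos_nonneg)
    have le: "- ln \<bar>y\<bar> / ln 2 \<le> real N + 1" unfolding N_def using nonneg by linarith
    have in_slab: "\<bar>y\<bar> \<le> (1/2)^m" if "m \<le> N" for m
    proof -
      have "real m \<le> - ln \<bar>y\<bar> / ln 2" using that nonneg unfolding N_def by linarith
      then have "real m * ln 2 \<le> - ln \<bar>y\<bar>" by (simp add: field_simps)
      then have "ln \<bar>y\<bar> \<le> ln ((1/2)^m)" by (simp add: ln_realpow ln_div)
      then show ?thesis using y by (subst (asm) ln_le_cancel_iff) auto
    qed
    have "ennreal \<bar>ln \<bar>y\<bar>\<bar> \<le> ennreal ((real N + 1) * ln 2)"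
      using le y by (intro ennreal_leI) (simp add: field_simps)
    also have "\<dots> = (\<Sum>m\<in>{..N}. ennreal (ln 2) * indicator {x. \<bar>x\<bar> \<le> (1/2)^m} y)"
      using in_slab by (simp add: ennreal_mult add.commute flip: ennreal_of_nat_eq_real_of_nat)
    also have "\<dots> \<le> (\<Sum>m. ennreal (ln 2) * indicator {x. \<bar>x\<bar> \<le> (1/2)^m} y)"
      by (rule sum_le_suminf) auto
    finally show ?thesis .
  qed
  show "integrable ?M (\<lambda>x. ln \<bar>x $ k\<bar>)"
  proof (rule integrableI_bounded)
    have [measurable]: "?B m \<in> sets borel" for m by measurable
    have "(\<integral>\<^sup>+x. ennreal (norm (ln \<bar>x $ k\<bar>)) \<partial>?M)
        \<le> (\<integral>\<^sup>+x. (\<Sum>m. ennreal (ln 2) * indicator (?B m) x) \<partial>?M)"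
    proof (rule nn_integral_mono_AE)
      show "AE x in ?M. ennreal (norm (ln \<bar>x $ k\<bar>)) \<le> (\<Sum>m. ennreal (ln 2) * indicator (?B m) x)"
        using nz AE_sphere_prob_norm
      proof eventually_elim
        case (elim x)
        then show ?case
          using bound[of "x $ k"] component_le_norm_cart[of x k] by (simp add: indicator_def)
      qed
    qed
    also have "\<dots> = (\<Sum>m. ennreal (ln 2) * emeasure ?M (?B m))"
      by (subst nn_integral_suminf) (auto simp: nn_integral_cmult_indicator intro!: borel_measurable_sphere_prob)
    also have "\<dots> \<le> (\<Sum>m. ennreal (ln 2 * \<bar>C\<bar> * (1/2)^m))"
    proof (intro suminf_le summableI)
      fix m
      have "emeasure ?M (?B m) \<le> ennreal (C * (1/2)^m)" by (rule C) simp
      also have "\<dots> \<le> ennreal (\<bar>C\<bar> * (1/2)^m)" by (intro ennreal_leI mult_right_mono) auto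
      finally have "ennreal (ln 2) * emeasure ?M (?B m) \<le> ennreal (ln 2) * ennreal (\<bar>C\<bar> * (1/2)^m)"
        by (rule mult_left_mono) (rule zero_le)
      also have "\<dots> = ennreal (ln 2 * \<bar>C\<bar> * (1/2)^m)"
        unfolding mult.assoc by (rule ennreal_mult[symmetric]) auto
      finally show "ennreal (ln 2) * emeasure ?M (?B m) \<le> ennreal (ln 2 * \<bar>C\<bar> * (1/2)^m)" .
    qed
    also have "\<dots> < \<infinity>"
    proof -
      have "summable (\<lambda>m. ln 2 * \<bar>C\<bar> * (1/2)^m)"
        by (intro summable_mult summable_geometric) auto
      then have "(\<Sum>m. ennreal (ln 2 * \<bar>C\<bar> * (1/2)^m)) \<noteq> top"
        by (rule ennreal_suminf_neq_top) simp
      then show ?thesis by (simp only: less_top[symmetric] infinity_ennreal_def) simp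
    qed
    finally show "(\<integral>\<^sup>+x. ennreal (norm (ln \<bar>x $ k\<bar>)) \<partial>?M) < \<infinity>" .
  qed (rule borel_measurable_sphere_prob, measurable)
qed

lemma measurable_orthogonal_transformation [measurable_dest]:
  "orthogonal_transformation (T :: 'a::euclidean_space \<Rightarrow> 'a) \<Longrightarrow> T \<in> borel_measurable borel"
  by (intro borel_measurable_continuous_onI linear_continuous_on)
    (simp add: linear_linear orthogonal_transformation_linear)

lemma measurable_matrix_vector_mult [measurable]:
  "(\<lambda>x. (A :: real^'n^'m) *v x) \<in> borel_measurable borel"
  by (intro borel_measurable_continuous_onI matrix_vector_mult_linear_continuous_on)

lemma integrable_sphere_prob_inner:
  fixes a :: "real^'n"
  assumes "a \<noteq> 0"
  shows "AE x in sphere_prob. a \<bullet> x \<noteq> 0" and "integrable sphere_prob (\<lambda>x. ln \<bar>a \<bullet> x\<bar>)"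
proof -
  fix k :: 'n
  obtain T :: "real^'n \<Rightarrow> real^'n" where T: "orthogonal_transformation T" and Ta: "T (a /\<^sub>R norm a) = axis k 1"
    using orthogonal_transformation_exists_1[of "a /\<^sub>R norm a" "axis k 1"] assms by auto
  have [measurable]: "T \<in> borel_measurable borel" using T by (rule measurable_orthogonal_transformation)
  have Tk: "a \<bullet> x = norm a * T x $ k" for x
  proof -
    have "T x $ k = T (a /\<^sub>R norm a) \<bullet> T x" by (simp add: Ta inner_axis')
    also have "\<dots> = (a /\<^sub>R norm a) \<bullet> x" using T by (simp add: orthogonal_transformation_def)
    finally show ?thesis using assms by (simp add: field_simps)
  qed
  let ?M = "sphere_prob :: (real^'n) measure"
  have "AE x in distr ?M borel T. x $ k \<noteq> 0"
    unfolding distr_sphere_prob_orthogonal[OF T] by (rule integrable_sphere_prob_coord(1))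
  then have nz: "AE x in ?M. T x $ k \<noteq> 0"
    by (subst (asm) AE_distr_iff) (auto cong: measurable_cong_sets)
  then show "AE x in ?M. a \<bullet> x \<noteq> 0" using assms by (simp add: Tk)
  have "integrable (distr ?M borel T) (\<lambda>x. ln \<bar>x $ k\<bar>)"
    unfolding distr_sphere_prob_orthogonal[OF T] by (rule integrable_sphere_prob_coord(2))
  then have "integrable ?M (\<lambda>x. ln \<bar>T x $ k\<bar>)"
    by (subst (asm) integrable_distr_eq) (auto cong: measurable_cong_sets)
  then have "integrable ?M (\<lambda>x. ln (norm a) + ln \<bar>T x $ k\<bar>)"
    using finite_measure.integrable_const[OF finite_measure_sphere_prob] by (intro Bochner_Integration.integrable_add) auto
  then show "integrable ?M (\<lambda>x. ln \<bar>a \<bullet> x\<bar>)"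
  proof (rule Bochner_Integration.integrable_cong_AE_imp)
    show "AE x in ?M. ln (norm a) + ln \<bar>T x $ k\<bar> = ln \<bar>a \<bullet> x\<bar>"
      using nz by eventually_elim (use assms in \<open>auto simp: Tk abs_mult ln_mult\<close>)
  qed (rule borel_measurable_sphere_prob, measurable)
qed

text \<open>On the sphere, \<open>norm (A *v x)\<close> lies between
  \<open>\<bar>a \<bullet> x\<bar>\<close> for a nonzero row \<open>a\<close> and the operator norm
  of \<open>A\<close>, so its logarithm is dominated from both sides.\<close>

lemma integrable_sphere_prob_ln_norm:
  fixes A :: "real^'n^'m"
  assumes "A \<noteq> 0"
  shows "AE x in sphere_prob. A *v x \<noteq> 0" and "integrable sphere_prob (\<lambda>x. ln (norm (A *v x)))"
proof -
  obtain i where i: "A $ i \<noteq> 0" using assms by (auto simp: vec_eq_iff)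
  let ?a = "A $ i" and ?M = "sphere_prob :: (real^'n) measure"
  have le: "\<bar>?a \<bullet> x\<bar> \<le> norm (A *v x)" for x
    using component_le_norm_cart[of "A *v x" i] by (simp add: matrix_vector_mul_component)
  show nz: "AE x in ?M. A *v x \<noteq> 0"
    using integrable_sphere_prob_inner(1)[OF i] by eventually_elim (metis abs_le_zero_iff le norm_zero)
  \<comment> \<open>The maximum with \<open>1\<close> makes \<open>ln K\<close> nonnegative, so that
    it can be added to the dominating function.\<close>
  define K where "K = max 1 (onorm ((*v) A))"
  have "integrable ?M (\<lambda>x. \<bar>ln \<bar>?a \<bullet> x\<bar>\<bar> + ln K)"
    using integrable_sphere_prob_inner(2)[OF i] finite_measure.integrable_const[OF finite_measure_sphere_prob]
    by (intro Bochner_Integration.integrable_add) auto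
  then show "integrable ?M (\<lambda>x. ln (norm (A *v x)))"
  proof (rule Bochner_Integration.integrable_bound)
    show "AE x in ?M. norm (ln (norm (A *v x))) \<le> norm (\<bar>ln \<bar>?a \<bullet> x\<bar>\<bar> + ln K)"
      using integrable_sphere_prob_inner(1)[OF i] AE_sphere_prob_norm
    proof eventually_elim
      case (elim x)
      have "norm (A *v x) \<le> onorm ((*v) A) * norm x" by (rule onorm) simp
      then have "norm (A *v x) \<le> K" using elim by (simp add: K_def)
      then have "ln (norm (A *v x)) \<le> ln K" using elim le[of x] by (intro ln_mono) auto
      moreover have "ln \<bar>?a \<bullet> x\<bar> \<le> ln (norm (A *v x))" using elim le[of x] by (intro ln_mono) auto
      moreover have "ln K \<ge> 0" by (simp add: K_def)
      ultimately show ?case by (simp add: abs_if split: if_splits)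
    qed
  qed (rule borel_measurable_sphere_prob, measurable)
qed

text \<open>Replaces the extended-valued definition by a Bochner integral. The convention
  \<open>ln 0 = 0\<close> is harmless, since \<open>A *v x = 0\<close> only on a null set.\<close>

lemma H0_norm_eq_exp_integral:
  fixes A :: "real^'n^'n"
  assumes "A \<noteq> 0"
  shows "H0_norm A = exp (\<integral>x. ln (norm (A *v x)) \<partial>sphere_prob)"
proof -
  let ?\<mu> = "normalized_surface_measure :: (real^'n) measure"
  let ?M = "sphere_prob :: (real^'n) measure"
  let ?f = "\<lambda>x. ln (norm (A *v x))"
  note nz = integrable_sphere_prob_ln_norm(1)[OF assms] and int = integrable_sphere_prob_ln_norm(2)[OF assms]
  have nz': "AE x in ?\<mu>. A *v x \<noteq> 0"
    using nz unfolding sphere_prob_def by (subst (asm) AE_distr_iff) auto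
  have M: "(\<integral>\<^sup>+x. ennreal (g x) \<partial>?M) = (\<integral>\<^sup>+x. ennreal (g x) \<partial>?\<mu>)"
    if "g \<in> borel_measurable borel" for g
    unfolding sphere_prob_def using that by (intro nn_integral_distr) simp_all
  have pos: "(\<integral>\<^sup>+x. e2ennreal (ext_ln (norm (A *v x))) \<partial>?\<mu>) = (\<integral>\<^sup>+x. ennreal (?f x) \<partial>?M)"
    by (subst M, measurable, rule nn_integral_cong_AE)
      (use nz' in eventually_elim, simp add: ext_ln_def)
  have neg: "(\<integral>\<^sup>+x. e2ennreal (- ext_ln (norm (A *v x))) \<partial>?\<mu>) = (\<integral>\<^sup>+x. ennreal (- ?f x) \<partial>?M)"
    by (subst M, measurable, rule nn_integral_cong_AE)
      (use nz' in eventually_elim, simp add: ext_ln_def)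
  obtain r q where "0 \<le> r" "0 \<le> q" "(\<integral>\<^sup>+x. ennreal (?f x) \<partial>?M) = ennreal r"
    "(\<integral>\<^sup>+x. ennreal (- ?f x) \<partial>?M) = ennreal q" "integral\<^sup>L ?M ?f = r - q"
    using int by (rule integrableE)
  then show ?thesis by (simp add: H0_norm_def ext_integral_def pos neg)
qed

subsection \<open>Integrals over the circle\<close>

text \<open>Over a full period \<open>G\<close> gains the same \<open>c\<close> from every starting
  point, so the shift \<open>t\<close> drops out. In the applications \<open>t\<close> is the
  initial angle of the rotated point.\<close>

lemma circle_integral_eq_increment:
  fixes G h :: "real \<Rightarrow> real"
  assumes "\<And>x. (G has_real_derivative h x) (at x)" "\<And>x. isCont h x" "\<And>x. G (x + 2 * pi) = G x + c"
  shows "(\<integral>\<theta>. h (\<theta> + t) * indicator {0..2 * pi} \<theta> \<partial>lborel) = c"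
proof -
  have "(\<integral>\<theta>. h (\<theta> + t) * indicator {0..2 * pi} \<theta> \<partial>lborel) = G (2 * pi + t) - G (0 + t)"
  proof (rule integral_FTC_Icc_real)
    show "((\<lambda>\<theta>. G (\<theta> + t)) has_real_derivative h (x + t)) (at x)" for x
      using assms(1)[of "x + t"] by (simp add: DERIV_shift)
    show "isCont (\<lambda>\<theta>. h (\<theta> + t)) x" for x
      by (rule isCont_o2[OF _ assms(2)]) simp
  qed simp
  then show ?thesis using assms(3)[of t] by (simp add: add.commute)
qed

context
  fixes \<alpha> \<beta> :: real
  assumes pos: "\<alpha> > 0" "\<beta> > 0"
begin

private definition q where "q x = \<alpha>^2 * (cos x)^2 + \<beta>^2 * (sin x)^2"

text \<open>
  A smooth version of \<open>arctan (\<beta> / \<alpha> * tan x) / (\<alpha> * \<beta>)\<close>, from \<open>arctan u - arctan v = arctan ((u - v) / (1 + u * v))\<close>.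
\<close>

private definition F where
  "F x = (x + arctan ((\<beta> - \<alpha>) * (sin x * cos x) / (\<alpha> * (cos x)^2 + \<beta> * (sin x)^2))) / (\<alpha> * \<beta>)"

text \<open>Its derivative supplies a term with denominator \<open>(q x)^2\<close>, which
  \<open>F\<close> cannot; being periodic, it adds nothing to an integral over the full
  circle.\<close>

private definition B where "B x = sin x * cos x / q x"

private lemma quadratic_pos: "a > 0 \<Longrightarrow> b > 0 \<Longrightarrow> a * (cos x)^2 + b * (sin x)^2 > (0::real)"
  using sin_cos_squared_add[of x]
  by (cases "cos x = 0") (auto intro!: add_pos_nonneg)

private lemma q_pos: "q x > 0"
  unfolding q_def by (rule quadratic_pos) (use pos in auto)

text \<open>If \<open>N / D\<close> is the argument of \<open>arctan\<close>, then
  \<open>D^2 + N^2 = q x\<close>, and the arctangent has derivative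
  \<open>\<alpha> * \<beta> / q x - 1\<close>. The summand \<open>x\<close> in \<open>F\<close>
  cancels the \<open>- 1\<close>.\<close>

private lemma DERIV_F: "(F has_real_derivative 1 / q x) (at x)"
proof -
  define s c where "s = sin x" and "c = cos x"
  have sc: "c^2 + s^2 = 1" by (simp add: s_def c_def)
  let ?N = "(\<beta> - \<alpha>) * (s * c)" and ?D = "\<alpha> * c^2 + \<beta> * s^2"
  have D: "?D > 0" unfolding s_def c_def by (rule quadratic_pos[OF pos])
  have Q: "?D^2 + ?N^2 = q x"
  proof -
    have "?D^2 + ?N^2 = (\<alpha>^2 * c^2 + \<beta>^2 * s^2) * (c^2 + s^2)"
      by (simp add: power2_eq_square algebra_simps)
    then show ?thesis by (simp add: sc q_def s_def c_def)
  qed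
  have N': "((\<lambda>x. (\<beta> - \<alpha>) * (sin x * cos x)) has_real_derivative (\<beta> - \<alpha>) * (c * c - s * s)) (at x)"
    unfolding s_def c_def by (auto intro!: derivative_eq_intros)
  have D': "((\<lambda>x. \<alpha> * (cos x)^2 + \<beta> * (sin x)^2) has_real_derivative 2 * (\<beta> - \<alpha>) * (s * c)) (at x)"
    unfolding s_def c_def by (auto intro!: derivative_eq_intros simp: algebra_simps)
  have "((\<lambda>x. arctan ((\<beta> - \<alpha>) * (sin x * cos x) / (\<alpha> * (cos x)^2 + \<beta> * (sin x)^2)))
      has_real_derivative inverse (1 + (?N / ?D)^2) *
        ((((\<beta> - \<alpha>) * (c * c - s * s)) * ?D - ?N * (2 * (\<beta> - \<alpha>) * (s * c))) / (?D * ?D))) (at x)"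
    using DERIV_chain2[OF DERIV_arctan DERIV_divide[OF N' D']] D unfolding s_def c_def by simp
  also have "((\<beta> - \<alpha>) * (c * c - s * s)) * ?D - ?N * (2 * (\<beta> - \<alpha>) * (s * c)) = \<alpha> * \<beta> - q x"
  proof -
    have "((\<beta> - \<alpha>) * (c * c - s * s)) * ?D - ?N * (2 * (\<beta> - \<alpha>) * (s * c))
        = (\<beta> - \<alpha>) * (\<alpha> * c^2 - \<beta> * s^2) * (c^2 + s^2)"
      by (simp add: power2_eq_square algebra_simps)
    also have "(\<beta> - \<alpha>) * (\<alpha> * c^2 - \<beta> * s^2) = \<alpha> * \<beta> * (c^2 + s^2) - q x"
      unfolding q_def s_def[symmetric] c_def[symmetric] by (simp add: power2_eq_square algebra_simps)
    finally show ?thesis by (simp add: sc)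
  qed
  also have "inverse (1 + (?N / ?D)^2) * ((\<alpha> * \<beta> - q x) / (?D * ?D)) = (\<alpha> * \<beta> - q x) / (?D^2 + ?N^2)"
  proof -
    have "1 + (n / d)^2 = (d^2 + n^2) / (d * d)" if "d > 0" for n d :: real
      using that by (simp add: power_divide field_simps power2_eq_square)
    then have "1 + (?N / ?D)^2 = (?D^2 + ?N^2) / (?D * ?D)" using D by blast
    then show ?thesis using D by simp
  qed
  also have "\<dots> = \<alpha> * \<beta> / q x - 1" unfolding Q using q_pos[of x] by (simp add: field_simps)
  finally have "(F has_real_derivative (1 + (\<alpha> * \<beta> / q x - 1)) / (\<alpha> * \<beta>)) (at x)"
    unfolding F_def[abs_def] by (intro DERIV_cdivide DERIV_add DERIV_ident)
  then show ?thesis using pos by simp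
qed

private lemma DERIV_B: "(B has_real_derivative (\<alpha>^2 * (cos x)^2 - \<beta>^2 * (sin x)^2) / (q x)^2) (at x)"
proof -
  define s c where "s = sin x" and "c = cos x"
  have sc: "c^2 + s^2 = 1" by (simp add: s_def c_def)
  have q: "q x = \<alpha>^2 * c^2 + \<beta>^2 * s^2" by (simp add: s_def c_def q_def)
  have eq: "((c * c - s * s) * q x - s * c * (2 * (\<beta>^2 - \<alpha>^2) * (s * c))) = \<alpha>^2 * c^2 - \<beta>^2 * s^2"
  proof -
    have "((c * c - s * s) * q x - s * c * (2 * (\<beta>^2 - \<alpha>^2) * (s * c))) = (\<alpha>^2 * c^2 - \<beta>^2 * s^2) * (c^2 + s^2)"
      unfolding q by (simp add: power2_eq_square algebra_simps)
    then show ?thesis by (simp add: sc)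
  qed
  have "(B has_real_derivative ((c * c - s * s) * q x - s * c * (2 * (\<beta>^2 - \<alpha>^2) * (s * c))) / (q x)^2) (at x)"
    using q_pos[of x] unfolding B_def[abs_def] q_def[abs_def] s_def c_def
    by (auto intro!: derivative_eq_intros simp: power2_eq_square algebra_simps)
  then show ?thesis unfolding eq by (simp add: s_def c_def)
qed

private lemma F_increment: "F (x + 2 * pi) = F x + 2 * pi / (\<alpha> * \<beta>)"
  by (simp add: F_def add_divide_distrib)

private lemma B_increment: "B (x + 2 * pi) = B x"
  by (simp add: B_def q_def)

private lemma isCont_q: "isCont q x"
  unfolding q_def[abs_def] by (intro continuous_intros)

text \<open>By \<open>q x - \<beta>^2 = (\<alpha>^2 - \<beta>^2) * (cos x)^2\<close> the integrand
  is a combination of \<open>1\<close> and \<open>1 / q x\<close>. This degenerates for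
  \<open>\<alpha> = \<beta>\<close>, where \<open>q\<close> is constant and the antiderivative is
  elementary.\<close>

lemma circle_integral_cos:
  "(\<integral>\<theta>. (cos (\<theta> + t))^2 / (\<alpha>^2 * (cos (\<theta> + t))^2 + \<beta>^2 * (sin (\<theta> + t))^2) * indicator {0..2 * pi} \<theta> \<partial>lborel)
    = 2 * pi / (\<alpha> * (\<alpha> + \<beta>))"
proof (cases "\<alpha> = \<beta>")
  case True
  let ?G = "\<lambda>x. (x + sin x * cos x) / (2 * \<alpha>^2)"
  show ?thesis
  proof (rule circle_integral_eq_increment)
    fix x
    have q: "\<alpha>^2 * (cos x)^2 + \<beta>^2 * (sin x)^2 = \<alpha>^2"
      by (simp add: True flip: distrib_left)
    have "((\<lambda>x. x + sin x * cos x) has_real_derivative 1 + ((cos x)^2 - (sin x)^2)) (at x)"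
      by (auto intro!: derivative_eq_intros simp: power2_eq_square)
    also have "1 + ((cos x)^2 - (sin x)^2) = 2 * (cos x)^2" by (simp add: sin_squared_eq)
    finally have "(?G has_real_derivative 2 * (cos x)^2 / (2 * \<alpha>^2)) (at x)" by (rule DERIV_cdivide)
    then show "(?G has_real_derivative (cos x)^2 / (\<alpha>^2 * (cos x)^2 + \<beta>^2 * (sin x)^2)) (at x)"
      unfolding q by simp
    show "isCont (\<lambda>x. (cos x)^2 / (\<alpha>^2 * (cos x)^2 + \<beta>^2 * (sin x)^2)) x"
      using q pos by (intro continuous_intros) auto
    show "?G (x + 2 * pi) = ?G x + 2 * pi / (\<alpha> * (\<alpha> + \<beta>))"
      unfolding cos_periodic sin_periodic using pos by (simp add: True field_simps power2_eq_square)
  qed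
next
  case False
  then have ne: "\<alpha>^2 - \<beta>^2 \<noteq> 0" using pos by (simp add: power2_eq_iff)
  let ?G = "\<lambda>x. (x - \<beta>^2 * F x) / (\<alpha>^2 - \<beta>^2)"
  show ?thesis
  proof (rule circle_integral_eq_increment, unfold q_def[symmetric])
    fix x
    have "(?G has_real_derivative (1 - \<beta>^2 * (1 / q x)) / (\<alpha>^2 - \<beta>^2)) (at x)"
      by (intro DERIV_cdivide DERIV_diff DERIV_cmult DERIV_F DERIV_ident)
    also have "(1 - \<beta>^2 * (1 / q x)) / (\<alpha>^2 - \<beta>^2) = (cos x)^2 / q x"
    proof -
      have "q x - \<beta>^2 = (\<alpha>^2 - \<beta>^2) * (cos x)^2"
        by (simp add: q_def sin_squared_eq algebra_simps)
      then show ?thesis using q_pos[of x] ne by (simp add: divide_simps)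
    qed
    finally show "(?G has_real_derivative (cos x)^2 / q x) (at x)" .
    show "isCont (\<lambda>x. (cos x)^2 / q x) x"
      using q_pos[of x] isCont_q by (intro continuous_intros) auto
    have "?G (x + 2 * pi) - ?G x = (2 * pi - \<beta>^2 * (2 * pi / (\<alpha> * \<beta>))) / (\<alpha>^2 - \<beta>^2)"
      unfolding F_increment diff_divide_distrib[symmetric]
      by (intro arg_cong2[where f = "(/)"] refl) (simp add: algebra_simps)
    also have "2 * pi - \<beta>^2 * (2 * pi / (\<alpha> * \<beta>)) = 2 * pi * (\<alpha> - \<beta>) / \<alpha>"
      using pos by (simp add: field_simps power2_eq_square)
    also have "2 * pi * (\<alpha> - \<beta>) / \<alpha> / (\<alpha>^2 - \<beta>^2) = 2 * pi / (\<alpha> * (\<alpha> + \<beta>))"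
    proof -
      have "\<alpha>^2 - \<beta>^2 = (\<alpha> - \<beta>) * (\<alpha> + \<beta>)" by (simp add: power2_eq_square algebra_simps)
      then show ?thesis using pos False by simp
    qed
    finally show "?G (x + 2 * pi) = ?G x + 2 * pi / (\<alpha> * (\<alpha> + \<beta>))" by simp
  qed
qed

text \<open>For \<open>\<alpha> \<noteq> \<beta>\<close> the integrand is a linear combination of
  \<open>1\<close>, \<open>1 / q x\<close> and the derivative of \<open>B\<close>, of which only the
  first two contribute to the increment.\<close>

lemma circle_integral_cos_sin:
  "(\<integral>\<theta>. (cos (\<theta> + t))^2 * (sin (\<theta> + t))^2 / (\<alpha>^2 * (cos (\<theta> + t))^2 + \<beta>^2 * (sin (\<theta> + t))^2)^2
      * indicator {0..2 * pi} \<theta> \<partial>lborel) = pi / (\<alpha> * \<beta> * (\<alpha> + \<beta>)^2)"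
proof (cases "\<alpha> = \<beta>")
  case True
  \<comment> \<open>The subtracted product is \<open>sin (4 * x) / 4\<close>, from
    \<open>8 * (cos x)^2 * (sin x)^2 = 1 - cos (4 * x)\<close>.\<close>
  let ?G = "\<lambda>x. (x - sin x * cos x * ((cos x)^2 - (sin x)^2)) / (8 * \<alpha>^4)"
  show ?thesis
  proof (rule circle_integral_eq_increment)
    fix x
    have q: "\<alpha>^2 * (cos x)^2 + \<beta>^2 * (sin x)^2 = \<alpha>^2"
      by (simp add: True flip: distrib_left)
    have "((\<lambda>x. x - sin x * cos x * ((cos x)^2 - (sin x)^2)) has_real_derivative
        1 - (((cos x)^2 - (sin x)^2)^2 - 4 * (sin x)^2 * (cos x)^2)) (at x)"
      by (auto intro!: derivative_eq_intros) (simp add: power2_eq_square algebra_simps)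
    also have "1 - (((cos x)^2 - (sin x)^2)^2 - 4 * (sin x)^2 * (cos x)^2) = 8 * (cos x)^2 * (sin x)^2"
      by (simp add: sin_squared_eq power2_eq_square[of "_ - _"] algebra_simps)
    finally have "(?G has_real_derivative 8 * (cos x)^2 * (sin x)^2 / (8 * \<alpha>^4)) (at x)"
      by (rule DERIV_cdivide)
    then show "(?G has_real_derivative (cos x)^2 * (sin x)^2 / (\<alpha>^2 * (cos x)^2 + \<beta>^2 * (sin x)^2)^2) (at x)"
      unfolding q by simp
    show "isCont (\<lambda>x. (cos x)^2 * (sin x)^2 / (\<alpha>^2 * (cos x)^2 + \<beta>^2 * (sin x)^2)^2) x"
      using q pos by (intro continuous_intros) auto
    show "?G (x + 2 * pi) = ?G x + pi / (\<alpha> * \<beta> * (\<alpha> + \<beta>)^2)"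
      unfolding cos_periodic sin_periodic using pos by (simp add: True field_simps power2_eq_square power4_eq_xxxx)
  qed
next
  case False
  then have ne: "\<alpha>^2 - \<beta>^2 \<noteq> 0" using pos by (simp add: power2_eq_iff)
  let ?G = "\<lambda>x. (- x + (\<alpha>^2 + \<beta>^2) / 2 * F x - (\<beta>^2 - \<alpha>^2) / 2 * B x) / (\<alpha>^2 - \<beta>^2)^2"
  show ?thesis
  proof (rule circle_integral_eq_increment, unfold q_def[symmetric])
    fix x
    let ?b = "(\<alpha>^2 * (cos x)^2 - \<beta>^2 * (sin x)^2) / (q x)^2"
    have "(?G has_real_derivative
        (- 1 + (\<alpha>^2 + \<beta>^2) / 2 * (1 / q x) - (\<beta>^2 - \<alpha>^2) / 2 * ?b) / (\<alpha>^2 - \<beta>^2)^2) (at x)"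
      by (intro DERIV_cdivide DERIV_diff DERIV_add DERIV_minus DERIV_cmult DERIV_F DERIV_B DERIV_ident)
    also have "(- 1 + (\<alpha>^2 + \<beta>^2) / 2 * (1 / q x) - (\<beta>^2 - \<alpha>^2) / 2 * ?b) / (\<alpha>^2 - \<beta>^2)^2
        = (cos x)^2 * (sin x)^2 / (q x)^2"
    proof -
      define C where "C = (cos x)^2"
      have S: "(sin x)^2 = 1 - C" by (simp add: C_def sin_squared_eq)
      have q: "q x = \<alpha>^2 * C + \<beta>^2 * (1 - C)" by (simp add: q_def S flip: C_def)
      have id1: "- ((q x)^2) + (\<alpha>^2 + \<beta>^2) / 2 * q x - (\<beta>^2 - \<alpha>^2) / 2 * (\<alpha>^2 * C - \<beta>^2 * (1 - C))
          = C * (1 - C) * (\<alpha>^2 - \<beta>^2)^2"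
        unfolding q by (simp add: power2_eq_square field_simps)
      have id2: "- 1 + u * (1 / d) - v * (w / d^2) = (- (d^2) + u * d - v * w) / d^2"
        if "d > 0" for u v w d :: real
        using that by (simp add: field_simps power2_eq_square)
      show ?thesis unfolding S C_def[symmetric] id2[OF q_pos] id1 using ne by simp
    qed
    finally show "(?G has_real_derivative (cos x)^2 * (sin x)^2 / (q x)^2) (at x)" .
    show "isCont (\<lambda>x. (cos x)^2 * (sin x)^2 / (q x)^2) x"
      using q_pos[of x] isCont_q by (intro continuous_intros) auto
    have "?G (x + 2 * pi) - ?G x
        = (- (2 * pi) + (\<alpha>^2 + \<beta>^2) / 2 * (2 * pi / (\<alpha> * \<beta>))) / (\<alpha>^2 - \<beta>^2)^2"
      unfolding F_increment B_increment diff_divide_distrib[symmetric]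
      by (intro arg_cong2[where f = "(/)"] refl) (simp add: algebra_simps)
    also have "- (2 * pi) + (\<alpha>^2 + \<beta>^2) / 2 * (2 * pi / (\<alpha> * \<beta>)) = pi * (\<alpha> - \<beta>)^2 / (\<alpha> * \<beta>)"
      using pos by (simp add: field_simps power2_eq_square)
    also have "pi * (\<alpha> - \<beta>)^2 / (\<alpha> * \<beta>) / (\<alpha>^2 - \<beta>^2)^2 = pi / (\<alpha> * \<beta> * (\<alpha> + \<beta>)^2)"
    proof -
      have "\<alpha>^2 - \<beta>^2 = (\<alpha> - \<beta>) * (\<alpha> + \<beta>)" by (simp add: power2_eq_square algebra_simps)
      then show ?thesis using pos False by (simp add: power_mult_distrib)
    qed
    finally show "?G (x + 2 * pi) = ?G x + pi / (\<alpha> * \<beta> * (\<alpha> + \<beta>)^2)" by simp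
  qed
qed

end

subsection \<open>Correlation of the weights\<close>

text \<open>Cosine and sine are separate arguments: averaging over the circle supplies them from an
  angle, the first-order condition for traces as a normalized vector
  \<open>(X / r, Y / r)\<close>.\<close>

definition givens :: "'n \<Rightarrow> 'n \<Rightarrow> real \<Rightarrow> real \<Rightarrow> real^'n^'n" where
  "givens i j a b = (\<chi> k l. if k = i then (if l = i then a else if l = j then - b else 0)
     else if k = j then (if l = i then b else if l = j then a else 0)
     else if k = l then 1 else 0)"

lemma sum_UNIV_remove2:
  fixes f :: "'n::finite \<Rightarrow> 'a::ab_group_add"
  assumes "i \<noteq> j"
  shows "sum f UNIV = f i + f j + sum f (UNIV - {i, j})"
proof -
  have "sum f UNIV = f i + sum f (UNIV - {i})" by (rule sum.remove) auto
  also have "sum f (UNIV - {i}) = f j + sum f (UNIV - {i} - {j})" using assms by (intro sum.remove) auto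
  also have "UNIV - {i} - {j} = UNIV - {i, j}" by auto
  finally show ?thesis by (simp add: add.assoc)
qed

lemma givens_mult_component:
  assumes "i \<noteq> j"
  shows "(givens i j a b *v x) $ k =
    (if k = i then a * x $ i - b * x $ j else if k = j then b * x $ i + a * x $ j else x $ k)"
proof -
  have "(givens i j a b *v x) $ k = (\<Sum>l\<in>UNIV. givens i j a b $ k $ l * x $ l)"
    by (simp add: matrix_vector_mult_def)
  also have "\<dots> = (if k = i then a * x $ i - b * x $ j else if k = j then b * x $ i + a * x $ j else x $ k)"
  proof (cases "k = i \<or> k = j")
    case True
    then show ?thesis using assms by (subst sum_UNIV_remove2[OF assms]) (auto simp: givens_def)
  next
    case False
    then have "(\<Sum>l\<in>UNIV. givens i j a b $ k $ l * x $ l) = (\<Sum>l\<in>UNIV. if k = l then x $ l else 0)"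
      by (intro sum.cong) (auto simp: givens_def)
    then show ?thesis using False by simp
  qed
  finally show ?thesis .
qed

lemma orthogonal_transformation_givens:
  fixes i j :: "'n::finite"
  assumes "i \<noteq> j" "a\<^sup>2 + b\<^sup>2 = 1"
  shows "orthogonal_transformation ((*v) (givens i j a b :: real^'n^'n))"
  unfolding orthogonal_transformation
proof (intro conjI allI)
  fix x :: "real^'n"
  let ?y = "givens i j a b *v x"
  have "(a * x $ i - b * x $ j)\<^sup>2 + (b * x $ i + a * x $ j)\<^sup>2 = (a\<^sup>2 + b\<^sup>2) * ((x $ i)\<^sup>2 + (x $ j)\<^sup>2)"
    by (simp add: power2_eq_square algebra_simps)
  then have "(\<Sum>k\<in>UNIV. (?y $ k)\<^sup>2) = (\<Sum>k\<in>UNIV. (x $ k)\<^sup>2)"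
    using assms by (simp add: sum_UNIV_remove2[OF assms(1)] givens_mult_component)
  then show "norm ?y = norm x" by (simp add: norm_vec_def L2_set_def)
qed simp

lemma orthogonal_matrix_givens:
  "i \<noteq> j \<Longrightarrow> a\<^sup>2 + b\<^sup>2 = 1 \<Longrightarrow> orthogonal_matrix (givens i j a b)"
  using orthogonal_transformation_givens[of i j a b] by (simp add: orthogonal_transformation_matrix)

lemma integral_sphere_prob_orthogonal:
  fixes T :: "'a::euclidean_space \<Rightarrow> 'a" and h :: "'a \<Rightarrow> real"
  assumes T: "orthogonal_transformation T" and [measurable]: "h \<in> borel_measurable borel"
  shows "(\<integral>x. h (T x) \<partial>sphere_prob) = integral\<^sup>L sphere_prob h"
proof -
  have "T \<in> sphere_prob \<rightarrow>\<^sub>M borel"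
    by (intro borel_measurable_sphere_prob measurable_orthogonal_transformation T)
  then have "integral\<^sup>L (distr sphere_prob borel T) h = (\<integral>x. h (T x) \<partial>sphere_prob)"
    by (intro integral_distr) auto
  then show ?thesis by (simp add: distr_sphere_prob_orthogonal[OF T])
qed

lemma integrable_sphere_prob_bounded:
  fixes h :: "'a::euclidean_space \<Rightarrow> real"
  assumes "h \<in> borel_measurable borel" "\<And>x. \<bar>h x\<bar> \<le> C"
  shows "integrable sphere_prob h"
  by (rule finite_measure.integrable_const_bound[OF finite_measure_sphere_prob, where B = C])
    (use assms in \<open>auto intro: borel_measurable_sphere_prob\<close>)

text \<open>Every rotation preserves \<open>sphere_prob\<close>, so integrating over the angle as
  well only contributes the factor \<open>2 * pi\<close>. The inner integral, divided by
  \<open>2 * pi\<close>, plays the part of a conditional expectation.\<close>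

lemma integral_sphere_prob_circle_average:
  fixes h :: "real^'n \<Rightarrow> real"
  assumes ij: "i \<noteq> j" and h[measurable]: "h \<in> borel_measurable borel" and bound: "\<And>x. \<bar>h x\<bar> \<le> 1"
  shows "2 * pi * integral\<^sup>L sphere_prob h =
    (\<integral>x. (\<integral>\<theta>. h (givens i j (cos \<theta>) (sin \<theta>) *v x) * indicator {0..2 * pi} \<theta> \<partial>lborel) \<partial>sphere_prob)"
proof -
  let ?M = "sphere_prob :: (real^'n) measure"
  let ?R = "\<lambda>x \<theta>. givens i j (cos \<theta>) (sin \<theta>) *v (x :: real^'n)"
  let ?h = "\<lambda>x \<theta>. h (?R x \<theta>) * indicator {0..2 * pi} \<theta>"
  interpret M: finite_measure ?M by (rule finite_measure_sphere_prob)
  interpret P: pair_sigma_finite ?M "lborel :: real measure" ..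
  have "(\<lambda>p. ?R (fst p) (snd p)) = (\<lambda>p. \<chi> k. if k = i then cos (snd p) * fst p $ i - sin (snd p) * fst p $ j
      else if k = j then sin (snd p) * fst p $ i + cos (snd p) * fst p $ j else fst p $ k)"
    by (simp add: fun_eq_iff vec_eq_iff givens_mult_component[OF ij])
  moreover have "continuous_on UNIV \<dots>"
  proof (rule continuous_on_vec_lambda)
    fix k
    show "continuous_on UNIV (\<lambda>p::(real^'n)\<times>real. if k = i then cos (snd p) * fst p $ i - sin (snd p) * fst p $ j
      else if k = j then sin (snd p) * fst p $ i + cos (snd p) * fst p $ j else fst p $ k)"
      by (cases "k = i"; cases "k = j") (auto intro!: continuous_intros)
  qed
  ultimately have R: "(\<lambda>p. ?R (fst p) (snd p)) \<in> borel_measurable (borel \<Otimes>\<^sub>M borel)"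
    unfolding borel_prod by (simp add: borel_measurable_continuous_onI)
  have meas: "case_prod ?h \<in> borel_measurable (?M \<Otimes>\<^sub>M lborel)"
  proof -
    have "(\<lambda>p. h (?R (fst p) (snd p)) * indicator {0..2 * pi} (snd p)) \<in> borel_measurable (borel \<Otimes>\<^sub>M borel)"
      using R by measurable
    then show ?thesis
      by (simp add: case_prod_unfold cong: measurable_cong_sets sets_pair_measure_cong)
  qed
  have "integrable (?M \<Otimes>\<^sub>M lborel) (case_prod ?h)"
  proof (rule integrableI_bounded_set[where A = "UNIV \<times> {0..2 * pi}" and B = 1])
    show "UNIV \<times> {0..2 * pi} \<in> sets (?M \<Otimes>\<^sub>M lborel)" by (intro pair_measureI) auto
    show "emeasure (?M \<Otimes>\<^sub>M lborel) (UNIV \<times> {0..2 * pi}) < \<infinity>"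
      by (subst lborel.emeasure_pair_measure_Times) (auto simp: emeasure_sphere_prob_UNIV)
    show "AE p in ?M \<Otimes>\<^sub>M lborel. p \<in> UNIV \<times> {0..2 * pi} \<longrightarrow> norm (case_prod ?h p) \<le> 1"
      using bound by (auto simp: indicator_def)
    show "AE p in ?M \<Otimes>\<^sub>M lborel. p \<notin> UNIV \<times> {0..2 * pi} \<longrightarrow> case_prod ?h p = 0"
      by (auto simp: indicator_def)
  qed (rule meas)
  then have "(\<integral>x. (\<integral>\<theta>. ?h x \<theta> \<partial>lborel) \<partial>?M) = (\<integral>\<theta>. (\<integral>x. ?h x \<theta> \<partial>?M) \<partial>lborel)"
    by (rule P.Fubini_integral[symmetric])
  also have "\<dots> = (\<integral>\<theta>. integral\<^sup>L ?M h * indicator {0..2 * pi} \<theta> \<partial>lborel)"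
    by (simp add: integral_sphere_prob_orthogonal[OF orthogonal_transformation_givens[OF ij] h])
  also have "\<dots> = 2 * pi * integral\<^sup>L ?M h" by simp
  finally show ?thesis by simp
qed

text \<open>The expectation of \<open>(f x - f y) * (g x - g y)\<close> over independent
  \<open>x\<close> and \<open>y\<close> is twice the difference of the two sides; it is computed as
  an iterated integral.\<close>

lemma Chebyshev_integral_inequality:
  fixes f g :: "'a::euclidean_space \<Rightarrow> real"
  assumes f: "integrable sphere_prob f" and g: "integrable sphere_prob g"
    and fg: "integrable sphere_prob (\<lambda>x. f x * g x)"
    and mono: "\<And>x y. 0 \<le> (f x - f y) * (g x - g y)"
  shows "integral\<^sup>L sphere_prob f * integral\<^sup>L sphere_prob g \<le> (\<integral>x. f x * g x \<partial>sphere_prob)"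
proof -
  let ?M = "sphere_prob :: 'a measure"
  let ?F = "integral\<^sup>L ?M f" and ?G = "integral\<^sup>L ?M g" and ?FG = "\<integral>x. f x * g x \<partial>?M"
  interpret finite_measure ?M by (rule finite_measure_sphere_prob)
  have "0 \<le> ?FG - f y * ?G - g y * ?F + f y * g y" for y
  proof -
    have "0 \<le> (\<integral>x. f x * g x - f y * g x - g y * f x + f y * g y \<partial>?M)"
      using mono[of _ y] by (intro integral_nonneg_AE AE_I2) (simp add: algebra_simps)
    also have "\<dots> = ?FG - f y * ?G - g y * ?F + f y * g y"
      using f g fg by simp
    finally show ?thesis .
  qed
  then have "0 \<le> (\<integral>y. ?FG - f y * ?G - g y * ?F + f y * g y \<partial>?M)"
    by (intro integral_nonneg_AE AE_I2)
  also have "\<dots> = 2 * (?FG - ?F * ?G)" using f g fg by simp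
  finally show ?thesis by simp
qed

section \<open>Coordinate weights and their averages over plane rotations\<close>

definition quad :: "real^'n \<Rightarrow> real^'n \<Rightarrow> real" where
  "quad s x = (\<Sum>k\<in>UNIV. (s $ k * x $ k)\<^sup>2)"

text \<open>The derivative of \<open>ln (quad s x) / 2\<close> with respect to
  \<open>ln (s $ i)\<close>. Where \<open>quad s x = 0\<close> the quotient is \<open>0\<close>, so
  the bounds \<open>0\<close> and \<open>1\<close> hold for every \<open>x\<close>, but the weights
  sum to \<open>1\<close> only elsewhere.\<close>

definition weight :: "real^'n \<Rightarrow> 'n \<Rightarrow> real^'n \<Rightarrow> real" where
  "weight s i x = (s $ i * x $ i)\<^sup>2 / quad s x"

lemma quad_nonneg: "0 \<le> quad s x"
  by (simp add: quad_def sum_nonneg)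

lemma component_le_quad: "(s $ i * x $ i)\<^sup>2 \<le> quad s x"
  unfolding quad_def by (rule member_le_sum) auto

lemma measurable_quad [measurable]: "quad s \<in> borel_measurable borel"
  unfolding quad_def[abs_def] by measurable

lemma measurable_weight [measurable]: "weight s i \<in> borel_measurable borel"
  unfolding weight_def[abs_def] by measurable

lemma weight_nonneg: "0 \<le> weight s i x"
  by (simp add: weight_def quad_nonneg)

lemma divide_le_1I: "0 \<le> y \<Longrightarrow> x \<le> y \<Longrightarrow> x / y \<le> (1::real)"
  by (cases "y = 0") (auto simp: divide_le_eq_1)

lemma weight_le_1: "weight s i x \<le> 1"
  unfolding weight_def by (intro divide_le_1I component_le_quad quad_nonneg)

lemma integrable_weight: "integrable sphere_prob (weight s i)"
  by (rule integrable_sphere_prob_bounded[where C = 1]) (auto simp: weight_nonneg weight_le_1)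

lemma weight_mult_le_1: "weight s i x * weight s j x \<le> 1"
  by (rule mult_le_one) (auto simp: weight_nonneg weight_le_1)

lemma integrable_weight_mult: "integrable sphere_prob (\<lambda>x. weight s i x * weight s j x)"
  by (rule integrable_sphere_prob_bounded[where C = 1])
    (auto simp: weight_nonneg weight_mult_le_1 abs_mult)

text \<open>
  The average of \<open>a X\<^sup>2 / (a X\<^sup>2 + b Y\<^sup>2 + c)\<close> over the circle \<open>X\<^sup>2 + Y\<^sup>2 = r\<close>. The product of this average
  and the one with \<open>a\<close>, \<open>b\<close> exchanged is twice the average of \<open>a b X\<^sup>2 Y\<^sup>2 / (a X\<^sup>2 + b Y\<^sup>2 + c)\<^sup>2\<close>.
\<close>

definition circle_weight :: "real \<Rightarrow> real \<Rightarrow> real \<Rightarrow> real \<Rightarrow> real" where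
  "circle_weight a b r c = a * r / (sqrt (a * r + c) * (sqrt (a * r + c) + sqrt (b * r + c)))"

lemma circle_weight_bounds:
  assumes "a > 0" "b > 0" "r \<ge> 0" "c \<ge> 0"
  shows "0 \<le> circle_weight a b r c" "circle_weight a b r c \<le> 1"
proof -
  show "0 \<le> circle_weight a b r c" using assms by (simp add: circle_weight_def)
  have "a * r \<le> sqrt (a * r + c) * sqrt (a * r + c)" using assms by simp
  also have "\<dots> \<le> sqrt (a * r + c) * (sqrt (a * r + c) + sqrt (b * r + c))"
    using assms by (intro mult_left_mono) auto
  finally show "circle_weight a b r c \<le> 1"
    unfolding circle_weight_def using assms by (intro divide_le_1I) auto
qed

lemma circle_weight_scale:
  assumes "r > 0" "c \<ge> 0" "a > 0" "b > 0"
  shows "circle_weight a b r c = circle_weight a b 1 (c / r)"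
proof -
  have sq: "sqrt (u * r + c) = sqrt r * sqrt (u + c / r)" for u
    using assms by (simp add: algebra_simps flip: real_sqrt_mult)
  have "circle_weight a b r c = a * r / ((sqrt r * sqrt r) * (sqrt (a + c / r) * (sqrt (a + c / r) + sqrt (b + c / r))))"
    unfolding circle_weight_def sq by (simp only: ring_distribs mult_ac)
  also have "sqrt r * sqrt r = r" using assms by simp
  finally show ?thesis using assms by (simp add: circle_weight_def)
qed

lemma circle_weight_antimono:
  assumes "a > 0" "b > 0" "0 \<le> c" "c \<le> d"
  shows "circle_weight a b 1 d \<le> circle_weight a b 1 c"
  unfolding circle_weight_def using assms
  by (intro divide_left_mono mult_mono add_mono mult_pos_pos) (auto intro: add_pos_pos)

text \<open>Scaling shows that both averages are decreasing functions of the single quantity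
  \<open>c / r\<close>. The case \<open>r = 0\<close> acts as an infinite ratio: both averages take
  their minimum \<open>0\<close>.\<close>

lemma circle_weight_comonotone:
  assumes "a > 0" "b > 0" "r \<ge> 0" "c \<ge> 0" "r' \<ge> 0" "c' \<ge> 0"
  shows "0 \<le> (circle_weight a b r c - circle_weight a b r' c') * (circle_weight b a r c - circle_weight b a r' c')"
proof (cases "r = 0 \<or> r' = 0")
  case True
  then show ?thesis
    using assms by (auto simp: circle_weight_def[of _ _ 0] circle_weight_bounds)
next
  case False
  then have r: "r > 0" "r' > 0" using assms by auto
  have eq: "circle_weight a b r c = circle_weight a b 1 (c / r)" "circle_weight b a r c = circle_weight b a 1 (c / r)"
    "circle_weight a b r' c' = circle_weight a b 1 (c' / r')" "circle_weight b a r' c' = circle_weight b a 1 (c' / r')"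
    using assms r by (auto intro: circle_weight_scale)
  show ?thesis
    unfolding eq using assms r circle_weight_antimono[of a b "c / r" "c' / r'"] circle_weight_antimono[of b a "c / r" "c' / r'"]
      circle_weight_antimono[of a b "c' / r'" "c / r"] circle_weight_antimono[of b a "c' / r'" "c / r"]
    by (cases "c / r \<le> c' / r'") (auto intro!: mult_nonneg_nonneg mult_nonpos_nonpos)
qed

text \<open>Rotation fixes \<open>r\<close> and \<open>c\<close>. Splitting \<open>c\<close> into
  \<open>c * (cos (\<theta> + t))\<^sup>2 + c * (sin (\<theta> + t))\<^sup>2\<close> absorbs it into
  the two moving terms, which turns \<open>quad s\<close> into the denominator of the circle
  integrals with \<open>\<alpha>\<^sup>2 = (s $ i)\<^sup>2 * r + c\<close> and
  \<open>\<beta>\<^sup>2 = (s $ j)\<^sup>2 * r + c\<close>. This is the origin of the square roots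
  in \<open>circle_weight\<close>.\<close>

lemma circle_integral_weight:
  fixes s x :: "real^'n"
  assumes ij: "i \<noteq> j" and s: "s $ i > 0" "s $ j > 0"
  defines "r \<equiv> (x $ i)\<^sup>2 + (x $ j)\<^sup>2" and "c \<equiv> \<Sum>k\<in>UNIV - {i, j}. (s $ k * x $ k)\<^sup>2"
    and "w \<equiv> \<lambda>k \<theta>. weight s k (givens i j (cos \<theta>) (sin \<theta>) *v x)"
  shows "(\<integral>\<theta>. w i \<theta> * indicator {0..2 * pi} \<theta> \<partial>lborel) = 2 * pi * circle_weight ((s $ i)\<^sup>2) ((s $ j)\<^sup>2) r c" (is ?thesis1)
    and "(\<integral>\<theta>. w j \<theta> * indicator {0..2 * pi} \<theta> \<partial>lborel) = 2 * pi * circle_weight ((s $ j)\<^sup>2) ((s $ i)\<^sup>2) r c" (is ?thesis2)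
    and "(\<integral>\<theta>. w i \<theta> * w j \<theta> * indicator {0..2 * pi} \<theta> \<partial>lborel)
      = pi * (circle_weight ((s $ i)\<^sup>2) ((s $ j)\<^sup>2) r c * circle_weight ((s $ j)\<^sup>2) ((s $ i)\<^sup>2) r c)" (is ?thesis3)
proof -
  have "?thesis1 \<and> ?thesis2 \<and> ?thesis3" if "r = 0"
  proof -
    have "x $ i = 0" "x $ j = 0" using that unfolding r_def by (auto simp: add_nonneg_eq_0_iff)
    then have "w i \<theta> = 0" "w j \<theta> = 0" for \<theta>
      using ij by (auto simp: w_def weight_def givens_mult_component)
    then show ?thesis using that by (simp add: circle_weight_def)
  qed
  moreover have "?thesis1 \<and> ?thesis2 \<and> ?thesis3" if "r \<noteq> 0"
  proof -
    have r: "r > 0" using that unfolding r_def by (simp add: order_less_le)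
    have c: "c \<ge> 0" unfolding c_def by (intro sum_nonneg) auto
    define \<alpha> \<beta> where "\<alpha> = sqrt ((s $ i)\<^sup>2 * r + c)" and "\<beta> = sqrt ((s $ j)\<^sup>2 * r + c)"
    have pos: "\<alpha> > 0" "\<beta> > 0"
      unfolding \<alpha>_def \<beta>_def using r c s by (auto intro!: add_pos_nonneg)
    have sq: "\<alpha>\<^sup>2 = (s $ i)\<^sup>2 * r + c" "\<beta>\<^sup>2 = (s $ j)\<^sup>2 * r + c"
      unfolding \<alpha>_def \<beta>_def using r c by auto
    have "(x $ i / sqrt r)\<^sup>2 + (x $ j / sqrt r)\<^sup>2 = 1"
      using r by (simp add: power_divide flip: add_divide_distrib) (simp add: r_def)
    \<comment> \<open>The angle of \<open>x\<close> in the \<open>(i, j)\<close> plane; rotation by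
      \<theta> turns it into \<open>\<theta> + t\<close>.\<close>
    then obtain t where t: "x $ i / sqrt r = cos t" "x $ j / sqrt r = sin t"
      by (rule sincos_total_2pi)
    then have x: "x $ i = sqrt r * cos t" "x $ j = sqrt r * sin t" using r by (auto simp: field_simps)
    let ?Q = "\<lambda>\<theta>. \<alpha>\<^sup>2 * (cos (\<theta> + t))\<^sup>2 + \<beta>\<^sup>2 * (sin (\<theta> + t))\<^sup>2"
    have yi: "(givens i j (cos \<theta>) (sin \<theta>) *v x) $ i = sqrt r * cos (\<theta> + t)"
      and yj: "(givens i j (cos \<theta>) (sin \<theta>) *v x) $ j = sqrt r * sin (\<theta> + t)" for \<theta>
      using ij by (simp_all add: givens_mult_component x cos_add sin_add algebra_simps)
    have Q: "quad s (givens i j (cos \<theta>) (sin \<theta>) *v x) = ?Q \<theta>" for \<theta>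
    proof -
      have "(\<Sum>k\<in>UNIV - {i, j}. (s $ k * (givens i j (cos \<theta>) (sin \<theta>) *v x) $ k)\<^sup>2) = c"
        unfolding c_def by (rule sum.cong) (auto simp: givens_mult_component[OF ij])
      then have "quad s (givens i j (cos \<theta>) (sin \<theta>) *v x) =
          (s $ i)\<^sup>2 * r * (cos (\<theta> + t))\<^sup>2 + (s $ j)\<^sup>2 * r * (sin (\<theta> + t))\<^sup>2 + c"
        using r unfolding quad_def sum_UNIV_remove2[OF ij] by (simp add: yi yj power_mult_distrib)
      moreover have "c = c * (cos (\<theta> + t))\<^sup>2 + c * (sin (\<theta> + t))\<^sup>2" by (simp flip: distrib_left)
      ultimately show ?thesis unfolding sq ring_distribs by linarith
    qed
    have wi: "w i \<theta> = (s $ i)\<^sup>2 * r * ((cos (\<theta> + t))\<^sup>2 / ?Q \<theta>)"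
      and wj: "w j \<theta> = (s $ j)\<^sup>2 * r * ((sin (\<theta> + t))\<^sup>2 / ?Q \<theta>)" for \<theta>
      using r by (simp_all add: w_def weight_def Q yi yj power_mult_distrib)
    have wij: "w i \<theta> * w j \<theta> = (s $ i)\<^sup>2 * r * ((s $ j)\<^sup>2 * r) * ((cos (\<theta> + t))\<^sup>2 * (sin (\<theta> + t))\<^sup>2 / (?Q \<theta>)\<^sup>2)" for \<theta>
      by (simp add: wi wj power2_eq_square[of "?Q \<theta>"])
    have cw: "circle_weight ((s $ i)\<^sup>2) ((s $ j)\<^sup>2) r c = (s $ i)\<^sup>2 * r / (\<alpha> * (\<alpha> + \<beta>))"
      "circle_weight ((s $ j)\<^sup>2) ((s $ i)\<^sup>2) r c = (s $ j)\<^sup>2 * r / (\<beta> * (\<beta> + \<alpha>))"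
      by (simp_all add: circle_weight_def \<alpha>_def \<beta>_def)
    have "?thesis1"
      unfolding wi mult.assoc[of "(s $ i)\<^sup>2 * r"] integral_mult_right_zero circle_integral_cos[OF pos] cw by simp
    moreover have "?thesis2"
    proof -
      \<comment> \<open>A quarter turn exchanges sine and cosine up to sign, so the integral for
        \<open>j\<close> is the one for \<open>i\<close> with \<alpha> and \<beta>
        exchanged.\<close>
      have "sin (\<theta> + t) = cos (\<theta> + (t - pi / 2))" "cos (\<theta> + t) = - sin (\<theta> + (t - pi / 2))" for \<theta>
        unfolding add_diff_eq by (simp_all add: cos_diff sin_diff)
      then have wj': "w j \<theta> = (s $ j)\<^sup>2 * r * ((cos (\<theta> + (t - pi / 2)))\<^sup>2 /
          (\<beta>\<^sup>2 * (cos (\<theta> + (t - pi / 2)))\<^sup>2 + \<alpha>\<^sup>2 * (sin (\<theta> + (t - pi / 2)))\<^sup>2))" for \<theta>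
        by (simp add: wj add.commute)
      show ?thesis
        unfolding wj' mult.assoc[of "(s $ j)\<^sup>2 * r"] integral_mult_right_zero circle_integral_cos[OF pos(2,1)] cw by simp
    qed
    moreover have "?thesis3"
      unfolding wij mult.assoc[of "(s $ i)\<^sup>2 * r * ((s $ j)\<^sup>2 * r)"] integral_mult_right_zero circle_integral_cos_sin[OF pos] cw
      by (simp add: power2_eq_square add.commute mult_ac)
    ultimately show ?thesis by blast
  qed
  ultimately show ?thesis1 ?thesis2 ?thesis3 by blast+
qed

lemma weight_correlation:
  fixes s :: "real^'n"
  assumes ij: "i \<noteq> j" and s: "s $ i > 0" "s $ j > 0"
  shows "integral\<^sup>L sphere_prob (weight s i) * integral\<^sup>L sphere_prob (weight s j)
    \<le> 2 * (\<integral>x. weight s i x * weight s j x \<partial>sphere_prob)"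
proof -
  define r where "r = (\<lambda>x::real^'n. (x $ i)\<^sup>2 + (x $ j)\<^sup>2)"
  define c where "c = (\<lambda>x::real^'n. \<Sum>k\<in>UNIV - {i, j}. (s $ k * x $ k)\<^sup>2)"
  define Ni where "Ni = (\<lambda>x. circle_weight ((s $ i)\<^sup>2) ((s $ j)\<^sup>2) (r x) (c x))"
  define Nj where "Nj = (\<lambda>x. circle_weight ((s $ j)\<^sup>2) ((s $ i)\<^sup>2) (r x) (c x))"
  have rc: "r x \<ge> 0" "c x \<ge> 0" for x by (auto simp: r_def c_def intro!: sum_nonneg)
  have s2: "(s $ i)\<^sup>2 > 0" "(s $ j)\<^sup>2 > 0" using s by auto
  have [measurable]: "Ni \<in> borel_measurable borel" "Nj \<in> borel_measurable borel"
    unfolding Ni_def Nj_def r_def c_def circle_weight_def by measurable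
  have N: "0 \<le> Ni x" "Ni x \<le> 1" "0 \<le> Nj x" "Nj x \<le> 1" for x
    unfolding Ni_def Nj_def using circle_weight_bounds[OF s2 rc] circle_weight_bounds[OF s2(2,1) rc] by auto
  have NN: "Ni x * Nj x \<le> 1" for x using N[of x] by (intro mult_le_one) auto
  note avg = circle_integral_weight[OF ij s]
  have "2 * pi * integral\<^sup>L sphere_prob (weight s i) = 2 * pi * integral\<^sup>L sphere_prob Ni"
    by (subst integral_sphere_prob_circle_average[OF ij])
      (auto simp: weight_nonneg weight_le_1 avg Ni_def r_def c_def)
  moreover have "2 * pi * integral\<^sup>L sphere_prob (weight s j) = 2 * pi * integral\<^sup>L sphere_prob Nj"
    by (subst integral_sphere_prob_circle_average[OF ij])
      (auto simp: weight_nonneg weight_le_1 avg Nj_def r_def c_def)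
  moreover have "2 * pi * (\<integral>x. weight s i x * weight s j x \<partial>sphere_prob) = pi * (\<integral>x. Ni x * Nj x \<partial>sphere_prob)"
    by (subst integral_sphere_prob_circle_average[OF ij])
      (auto simp: weight_nonneg weight_mult_le_1 abs_mult avg Ni_def Nj_def r_def c_def)
  moreover have "integral\<^sup>L sphere_prob Ni * integral\<^sup>L sphere_prob Nj \<le> (\<integral>x. Ni x * Nj x \<partial>sphere_prob)"
  proof (rule Chebyshev_integral_inequality)
    show "0 \<le> (Ni x - Ni y) * (Nj x - Nj y)" for x y
      unfolding Ni_def Nj_def by (intro circle_weight_comonotone s2 rc)
  qed (rule integrable_sphere_prob_bounded[where C = 1], auto simp: N NN abs_mult)+
  ultimately show ?thesis by simp
qed

subsection \<open>Convexity on diagonal matrices\<close>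

text \<open>By the mean value theorem the constant \<open>K\<close> dominates the difference
  quotients, and constants are integrable for a finite measure; dominated convergence does the
  rest.\<close>

lemma DERIV_integral_sphere_prob:
  fixes f f' :: "real \<Rightarrow> 'a::euclidean_space \<Rightarrow> real"
  assumes \<delta>: "\<delta> > 0"
    and int: "\<And>t. t \<in> ball t0 \<delta> \<Longrightarrow> integrable sphere_prob (f t)"
    and deriv: "\<And>t x. t \<in> ball t0 \<delta> \<Longrightarrow> ((\<lambda>t. f t x) has_real_derivative f' t x) (at t)"
    and bound: "\<And>t x. t \<in> ball t0 \<delta> \<Longrightarrow> \<bar>f' t x\<bar> \<le> K"
    and meas: "f' t0 \<in> borel_measurable borel"
  shows "((\<lambda>t. integral\<^sup>L sphere_prob (f t)) has_real_derivative integral\<^sup>L sphere_prob (f' t0)) (at t0)"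
  unfolding DERIV_def tendsto_at_iff_sequentially comp_def
proof (intro allI impI)
  let ?M = "sphere_prob :: 'a measure"
  fix X :: "nat \<Rightarrow> real" assume X: "\<forall>i. X i \<in> UNIV - {0}" "X \<longlonglongrightarrow> 0"
  then obtain N where "\<And>n. n \<ge> N \<Longrightarrow> \<bar>X n\<bar> < \<delta>"
    using \<delta> unfolding LIMSEQ_iff by fastforce
  define Y where "Y n = X (n + N)" for n
  have Y: "Y n \<noteq> 0" "\<bar>Y n\<bar> < \<delta>" "Y \<longlonglongrightarrow> 0" for n
    using X LIMSEQ_ignore_initial_segment[OF X(2), of N] \<open>\<And>n. n \<ge> N \<Longrightarrow> \<bar>X n\<bar> < \<delta>\<close>
    by (auto simp: Y_def[abs_def])
  have ball: "t0 + Y n \<in> ball t0 \<delta>" "t0 \<in> ball t0 \<delta>" for n using Y(2)[of n] \<delta> by (auto simp: dist_real_def)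
  have "(\<lambda>n. \<integral>x. (f (t0 + Y n) x - f t0 x) / Y n \<partial>?M) \<longlonglongrightarrow> integral\<^sup>L ?M (f' t0)"
  proof (rule integral_dominated_convergence[where w = "\<lambda>_. K"])
    show "f' t0 \<in> borel_measurable ?M" using meas by (rule borel_measurable_sphere_prob)
    show "integrable ?M (\<lambda>_. K)" by (rule finite_measure.integrable_const[OF finite_measure_sphere_prob])
    show "(\<lambda>x. (f (t0 + Y n) x - f t0 x) / Y n) \<in> borel_measurable ?M" for n
      using borel_measurable_integrable[OF int[OF ball(1)], of n] borel_measurable_integrable[OF int[OF ball(2)]] by measurable
    show "AE x in ?M. (\<lambda>n. (f (t0 + Y n) x - f t0 x) / Y n) \<longlonglongrightarrow> f' t0 x"
    proof (rule AE_I2)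
      fix x
      have "((\<lambda>h. (f (t0 + h) x - f t0 x) / h) \<longlongrightarrow> f' t0 x) (at 0)"
        using deriv[OF ball(2), of x] by (simp add: DERIV_def)
      then show "(\<lambda>n. (f (t0 + Y n) x - f t0 x) / Y n) \<longlonglongrightarrow> f' t0 x"
        unfolding tendsto_at_iff_sequentially comp_def using Y by auto
    qed
    show "AE x in ?M. norm ((f (t0 + Y n) x - f t0 x) / Y n) \<le> K" for n
    proof (rule AE_I2)
      fix x
      have "norm (f (t0 + Y n) x - f t0 x) \<le> K * norm (t0 + Y n - t0)"
      proof (rule field_differentiable_bound[where S = "ball t0 \<delta>" and f' = "\<lambda>t. f' t x"])
        show "((\<lambda>t. f t x) has_field_derivative f' t x) (at t within ball t0 \<delta>)" if "t \<in> ball t0 \<delta>" for t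
          using deriv[OF that] by (rule has_field_derivative_at_within)
      qed (use bound ball in auto)
      then show "norm ((f (t0 + Y n) x - f t0 x) / Y n) \<le> K" using Y(1)[of n] by (simp add: divide_le_eq)
    qed
  qed
  then have "(\<lambda>n. (integral\<^sup>L ?M (f (t0 + Y n)) - integral\<^sup>L ?M (f t0)) / Y n) \<longlonglongrightarrow> integral\<^sup>L ?M (f' t0)"
    using int[OF ball(1)] int[OF ball(2)] by simp
  then show "(\<lambda>n. (integral\<^sup>L ?M (f (t0 + X n)) - integral\<^sup>L ?M (f t0)) / X n) \<longlonglongrightarrow> integral\<^sup>L ?M (f' t0)"
    unfolding Y_def by (rule LIMSEQ_offset)
qed

text \<open>The difference of the two sides is half the sum of
  \<open>K i j * (u i - u j)\<^sup>2\<close>. Diagonal entries of \<open>K\<close> may have any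
  sign, since their terms vanish.\<close>

lemma weighted_variance_nonneg:
  fixes K :: "'n::finite \<Rightarrow> 'n \<Rightarrow> real"
  assumes sym: "\<And>i j. K i j = K j i" and row: "\<And>i. (\<Sum>j\<in>UNIV. K i j) = P i"
    and nonneg: "\<And>i j. i \<noteq> j \<Longrightarrow> 0 \<le> K i j"
  shows "(\<Sum>i\<in>UNIV. \<Sum>j\<in>UNIV. K i j * (u i * u j)) \<le> (\<Sum>i\<in>UNIV. P i * (u i)\<^sup>2)"
proof -
  have "0 \<le> (\<Sum>i\<in>UNIV. \<Sum>j\<in>UNIV. K i j * (u i - u j)\<^sup>2)"
  proof (intro sum_nonneg)
    show "0 \<le> K i j * (u i - u j)\<^sup>2" for i j by (cases "i = j") (auto simp: nonneg)
  qed
  also have "\<dots> = (\<Sum>i\<in>UNIV. \<Sum>j\<in>UNIV. K i j * (u i)\<^sup>2) + (\<Sum>i\<in>UNIV. \<Sum>j\<in>UNIV. K i j * (u j)\<^sup>2)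
      - 2 * (\<Sum>i\<in>UNIV. \<Sum>j\<in>UNIV. K i j * (u i * u j))"
    unfolding sum_distrib_left sum.distrib[symmetric] sum_subtractf[symmetric]
    by (intro sum.cong refl) (simp add: power2_eq_square algebra_simps)
  also have "(\<Sum>i\<in>UNIV. \<Sum>j\<in>UNIV. K i j * (u j)\<^sup>2) = (\<Sum>i\<in>UNIV. \<Sum>j\<in>UNIV. K i j * (u i)\<^sup>2)"
    by (subst sum.swap) (simp add: sym)
  also have "\<dots> = (\<Sum>i\<in>UNIV. P i * (u i)\<^sup>2)"
    by (simp add: row flip: sum_distrib_right)
  finally show ?thesis by simp
qed

lemma quad_eq_0_iff:
  assumes "\<And>i. s $ i > 0"
  shows "quad s x = 0 \<longleftrightarrow> x = 0"
proof -
  have "quad s x = 0 \<longleftrightarrow> (\<forall>i. s $ i * x $ i = 0)"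
    by (simp add: quad_def sum_nonneg_eq_0_iff)
  then show ?thesis using assms by (simp add: vec_eq_iff) (metis less_irrefl)
qed

lemma sum_weight: "quad s x \<noteq> 0 \<Longrightarrow> (\<Sum>i\<in>UNIV. weight s i x) = 1"
  by (simp add: weight_def quad_def flip: sum_divide_distrib)

lemma sum_integral_weight:
  fixes s :: "real^'n"
  assumes "\<And>i. s $ i > 0"
  shows "(\<Sum>i\<in>UNIV. integral\<^sup>L sphere_prob (weight s i)) = 1"
proof -
  have "(\<Sum>i\<in>UNIV. integral\<^sup>L sphere_prob (weight s i)) = (\<integral>x. (\<Sum>i\<in>UNIV. weight s i x) \<partial>sphere_prob)"
    by (simp add: integrable_weight)
  also have "\<dots> = (\<integral>x. 1 \<partial>(sphere_prob :: (real^'n) measure))"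
  proof (rule integral_cong_AE)
    show "AE x in sphere_prob. (\<Sum>i\<in>UNIV. weight s i x) = 1"
      using AE_sphere_prob_norm by eventually_elim (auto intro!: sum_weight simp: quad_eq_0_iff[OF assms])
  qed (auto intro: borel_measurable_sphere_prob)
  finally show ?thesis by simp
qed

text \<open>For \<open>exp (E[L])\<close> the second derivative divided by the value is
  \<open>E[L''] + E[L']\<^sup>2\<close>; this is that expression in the logarithmic direction
  \<open>u\<close>. With first and second moments \<open>P\<close> and \<open>m\<close>, the
  coefficients \<open>2 * m i j - P i * P j\<close> have row sums \<open>2 * P i - P i\<close>,
  because the weights sum to \<open>1\<close> almost everywhere.\<close>

lemma second_variation_nonneg:
  fixes s :: "real^'n"
  assumes s: "\<And>i. s $ i > 0"
  shows "0 \<le> (\<integral>x. (\<Sum>i\<in>UNIV. weight s i x * (u i)\<^sup>2) - 2 * (\<Sum>i\<in>UNIV. weight s i x * u i)\<^sup>2 \<partial>sphere_prob)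
    + (\<integral>x. (\<Sum>i\<in>UNIV. weight s i x * u i) \<partial>sphere_prob)\<^sup>2"
proof -
  define P where "P = (\<lambda>i. integral\<^sup>L sphere_prob (weight s i))"
  define m where "m = (\<lambda>i j. \<integral>x. weight s i x * weight s j x \<partial>sphere_prob)"
  have sq: "(\<Sum>i\<in>UNIV. f i * u i)\<^sup>2 = (\<Sum>i\<in>UNIV. \<Sum>j\<in>UNIV. f i * f j * (u i * u j))" for f
    by (simp add: power2_eq_square sum_product mult_ac)
  have row: "(\<Sum>j\<in>UNIV. m i j) = P i" for i
  proof -
    have "(\<Sum>j\<in>UNIV. m i j) = (\<integral>x. (\<Sum>j\<in>UNIV. weight s i x * weight s j x) \<partial>sphere_prob)"
      unfolding m_def by (simp add: integrable_weight_mult)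
    also have "(\<lambda>x. \<Sum>j\<in>UNIV. weight s i x * weight s j x) = weight s i"
    proof
      fix x
      show "(\<Sum>j\<in>UNIV. weight s i x * weight s j x) = weight s i x"
      proof (cases "quad s x = 0")
        case True
        then show ?thesis by (simp add: weight_def)
      next
        case False
        then show ?thesis using sum_weight[of s x] by (simp flip: sum_distrib_left)
      qed
    qed
    finally show ?thesis by (simp add: P_def)
  qed
  have "(\<Sum>i\<in>UNIV. \<Sum>j\<in>UNIV. (2 * m i j - P i * P j) * (u i * u j)) \<le> (\<Sum>i\<in>UNIV. P i * (u i)\<^sup>2)"
  proof (rule weighted_variance_nonneg)
    show "2 * m i j - P i * P j = 2 * m j i - P j * P i" for i j by (simp add: m_def mult.commute)
    show "(\<Sum>j\<in>UNIV. 2 * m i j - P i * P j) = P i" for i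
      using sum_integral_weight[OF s] by (simp add: sum_subtractf row flip: sum_distrib_left) (simp add: P_def)
    show "0 \<le> 2 * m i j - P i * P j" if "i \<noteq> j" for i j
      using weight_correlation[OF that s s] by (simp add: m_def P_def)
  qed
  then have "0 \<le> (\<Sum>i\<in>UNIV. P i * (u i)\<^sup>2) - 2 * (\<Sum>i\<in>UNIV. \<Sum>j\<in>UNIV. m i j * (u i * u j))
      + (\<Sum>i\<in>UNIV. \<Sum>j\<in>UNIV. P i * P j * (u i * u j))"
    by (simp add: left_diff_distrib sum_subtractf mult.assoc flip: sum_distrib_left)
  also have "(\<Sum>i\<in>UNIV. \<Sum>j\<in>UNIV. P i * P j * (u i * u j)) = (\<integral>x. (\<Sum>i\<in>UNIV. weight s i x * u i) \<partial>sphere_prob)\<^sup>2"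
    by (simp add: sq[symmetric] P_def integrable_weight)
  also have "(\<Sum>i\<in>UNIV. P i * (u i)\<^sup>2) - 2 * (\<Sum>i\<in>UNIV. \<Sum>j\<in>UNIV. m i j * (u i * u j)) =
      (\<integral>x. (\<Sum>i\<in>UNIV. weight s i x * (u i)\<^sup>2) - 2 * (\<Sum>i\<in>UNIV. weight s i x * u i)\<^sup>2 \<partial>sphere_prob)"
    by (simp add: sq P_def m_def integrable_weight integrable_weight_mult)
  finally show ?thesis .
qed

section \<open>The norm of diagonal matrices and its gradient\<close>

definition diag_matrix :: "real^'n \<Rightarrow> real^'n^'n" where
  "diag_matrix s = (\<chi> i j. if i = j then s $ i else 0)"

lemma diag_matrix_mult_component: "(diag_matrix s *v x) $ i = s $ i * x $ i"
proof -
  have "(diag_matrix s *v x) $ i = (\<Sum>j\<in>UNIV. (if i = j then s $ i else 0) * x $ j)"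
    by (simp add: matrix_vector_mult_def diag_matrix_def)
  also have "\<dots> = (\<Sum>j\<in>UNIV. if i = j then s $ i * x $ j else 0)"
    by (rule sum.cong) auto
  finally show ?thesis by simp
qed

lemma norm_diag_matrix_mult: "norm (diag_matrix s *v x) = sqrt (quad s x)"
  by (simp add: norm_vec_def L2_set_def diag_matrix_mult_component quad_def)

lemma ln_norm_diag_matrix_mult: "ln (norm (diag_matrix s *v x)) = ln (quad s x) / 2"
  using quad_nonneg[of s x] by (cases "quad s x = 0") (auto simp: norm_diag_matrix_mult ln_sqrt)

lemma diag_matrix_eq_0_iff [simp]: "diag_matrix s = 0 \<longleftrightarrow> s = 0"
  by (auto simp: diag_matrix_def vec_eq_iff)

lemma integrable_ln_quad: "s \<noteq> 0 \<Longrightarrow> integrable sphere_prob (\<lambda>x. ln (quad s x) / 2)"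
  using integrable_sphere_prob_ln_norm(2)[of "diag_matrix s"] by (simp add: ln_norm_diag_matrix_mult)

lemma H0_norm_diag_matrix:
  "s \<noteq> 0 \<Longrightarrow> H0_norm (diag_matrix s) = exp (\<integral>x. ln (quad s x) / 2 \<partial>sphere_prob)"
  by (simp add: H0_norm_eq_exp_integral ln_norm_diag_matrix_mult)

text \<open>The supporting hyperplane of the convex function \<open>s \<mapsto> H0_norm (diag_matrix s)\<close> at positive \<open>s\<close>.\<close>

definition H0_grad :: "real^'n \<Rightarrow> 'n \<Rightarrow> real" where
  "H0_grad s i = H0_norm (diag_matrix s) * integral\<^sup>L sphere_prob (weight s i) / s $ i"

lemma H0_grad_supporting_pos:
  fixes s b :: "real^'n"
  assumes s: "\<And>i. s $ i > 0" and b: "\<And>i. b $ i > 0"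
  shows "H0_norm (diag_matrix s) + (\<Sum>i\<in>UNIV. H0_grad s i * (b $ i - s $ i)) \<le> H0_norm (diag_matrix b)"
proof -
  let ?M = "sphere_prob :: (real^'n) measure"
  define v where "v = b - s"
  define S where "S t = s + t *\<^sub>R v" for t
  \<comment> \<open>An open interval containing \<open>0\<close> and \<open>1\<close> on which all
    entries stay positive; the tangent at \<open>0\<close> requires an interior point.\<close>
  define T where "T = {t. \<forall>i. S t $ i > 0}"
  define L where "L t x = ln (quad (S t) x) / 2" for t and x :: "real^'n"
  \<comment> \<open>The first two derivatives of \<open>L\<close> in \<open>t\<close>, written with
    the weights and the logarithmic direction \<open>v $ i / S t $ i\<close> to match
    \<open>second_variation_nonneg\<close>.\<close>
  define d1 where "d1 t x = (\<Sum>i\<in>UNIV. weight (S t) i x * (v $ i / S t $ i))" for t x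
  define d2 where "d2 t x = (\<Sum>i\<in>UNIV. weight (S t) i x * (v $ i / S t $ i)\<^sup>2)
      - 2 * (\<Sum>i\<in>UNIV. weight (S t) i x * (v $ i / S t $ i))\<^sup>2" for t x
  have [measurable]: "d1 t \<in> borel_measurable borel" "d2 t \<in> borel_measurable borel" for t
    unfolding d1_def d2_def by measurable
  have S_ne: "S t \<noteq> 0" if "t \<in> T" for t
    using that unfolding T_def by (metis (mono_tags, lifting) less_irrefl mem_Collect_eq zero_index)
  \<comment> \<open>A common lower bound \<open>m\<close> for the entries near \<open>t0\<close>
    bounds \<open>d1\<close> and \<open>d2\<close> uniformly in \<open>x\<close>, as differentiation
    under the integral requires.\<close>
  have local: "\<exists>\<delta>>0. \<exists>m>0. \<forall>t\<in>ball t0 \<delta>. \<forall>i. m \<le> S t $ i" if "t0 \<in> T" for t0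
  proof -
    define m where "m = Min (range (\<lambda>i. S t0 $ i)) / 2"
    have m: "m > 0" "2 * m \<le> S t0 $ i" for i
      using that by (auto simp: m_def T_def)
    define \<delta> where "\<delta> = m / (1 + norm v)"
    have "\<delta> > 0" using m by (simp add: \<delta>_def add_pos_nonneg)
    moreover have "m \<le> S t $ i" if "t \<in> ball t0 \<delta>" for t i
    proof -
      have "\<bar>(t - t0) * v $ i\<bar> \<le> \<delta> * (1 + norm v)"
        unfolding abs_mult using that component_le_norm_cart[of v i]
        by (intro mult_mono) (auto simp: dist_real_def)
      also have "\<dots> = m" by (simp add: \<delta>_def add_nonneg_eq_0_iff)
      finally have "\<bar>(t - t0) * v $ i\<bar> \<le> m" .
      moreover have "S t $ i = S t0 $ i + (t - t0) * v $ i" by (simp add: S_def algebra_simps)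
      ultimately show ?thesis using m(2)[of i] by linarith
    qed
    ultimately show ?thesis using m(1) by blast
  qed
  have openT: "open T"
    unfolding open_contains_ball
  proof
    fix t0 assume "t0 \<in> T"
    then obtain \<delta> m where "\<delta> > 0" "m > 0" "\<forall>t\<in>ball t0 \<delta>. \<forall>i. m \<le> S t $ i" using local by metis
    then show "\<exists>\<delta>>0. ball t0 \<delta> \<subseteq> T" unfolding T_def by (intro exI[of _ \<delta>]) (force intro: less_le_trans)
  qed
  have convT: "convex T"
  proof -
    have "T = (\<Inter>i. {t. 0 < s $ i + t * v $ i})" by (auto simp: T_def S_def)
    moreover have "convex {t. 0 < s $ i + t * v $ i}" for i
    proof -
      have "{t. 0 < s $ i + t * v $ i} = {t. inner (v $ i) t > - (s $ i)}" by (auto simp: mult.commute)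
      then show ?thesis by (simp only: convex_halfspace_gt)
    qed
    ultimately show ?thesis by (auto intro: convex_INT)
  qed
  have S_deriv: "((\<lambda>t. S t $ i) has_real_derivative v $ i) (at t)" for i t
    unfolding S_def by (auto intro!: derivative_eq_intros)
  \<comment> \<open>\<open>N\<close> and \<open>N'\<close> are half the first and second derivatives
    of \<open>quad (S t) x\<close>; in these terms no entry of \<open>S t\<close> occurs in a
    denominator.\<close>
  define N where "N t x = (\<Sum>i\<in>UNIV. S t $ i * v $ i * (x $ i)\<^sup>2)" for t x
  define N' where "N' x = (\<Sum>i\<in>UNIV. (v $ i)\<^sup>2 * (x $ i)\<^sup>2)" for x
  have q_deriv: "((\<lambda>t. quad (S t) x) has_real_derivative 2 * N t x) (at t)" for t x
  proof -
    have "((\<lambda>t. quad (S t) x) has_real_derivative (\<Sum>i\<in>UNIV. 2 * (S t $ i * v $ i * (x $ i)\<^sup>2))) (at t)"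
      unfolding quad_def
      by (rule DERIV_sum) (auto intro!: derivative_eq_intros S_deriv simp: power2_eq_square)
    then show ?thesis by (simp add: N_def sum_distrib_left)
  qed
  have N_deriv: "((\<lambda>t. N t x) has_real_derivative N' x) (at t)" for t x
    unfolding N_def N'_def
    by (rule DERIV_sum) (auto intro!: derivative_eq_intros S_deriv simp: power2_eq_square)
  have d1_eq: "d1 t x = N t x / quad (S t) x" if "t \<in> T" for t x
  proof -
    have "S t $ i > 0" for i using that by (simp add: T_def)
    then have "weight (S t) i x * (v $ i / S t $ i) = S t $ i * v $ i * (x $ i)\<^sup>2 / quad (S t) x" for i
      by (simp add: weight_def power2_eq_square)
    then show ?thesis by (simp add: d1_def N_def sum_divide_distrib)
  qed
  have d2_eq: "d2 t x = N' x / quad (S t) x - 2 * (N t x / quad (S t) x)\<^sup>2" if "t \<in> T" for t x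
  proof -
    have "S t $ i > 0" for i using that by (simp add: T_def)
    then have "weight (S t) i x * (v $ i / S t $ i)\<^sup>2 = (v $ i)\<^sup>2 * (x $ i)\<^sup>2 / quad (S t) x" for i
      by (simp add: weight_def power2_eq_square) (metis less_irrefl)
    then show ?thesis using d1_eq[OF that, of x] by (simp add: d2_def d1_def N'_def sum_divide_distrib)
  qed
  have zero: "N t 0 = 0" "N' 0 = 0" "quad (S t) 0 = 0" for t by (simp_all add: N_def N'_def quad_def)
  have q_pos: "quad (S t) x > 0" if "t \<in> T" "x \<noteq> 0" for t x
    using quad_eq_0_iff[of "S t" x] quad_nonneg[of "S t" x] that by (simp add: T_def order_less_le)
  \<comment> \<open>At \<open>x = 0\<close> the conventions for \<open>ln 0\<close> and division by
    \<open>0\<close> make \<open>L\<close> and \<open>d1\<close> vanish on \<open>T\<close>, so the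
    derivative exists for every \<open>x\<close>, not just almost everywhere.\<close>
  have L_deriv: "((\<lambda>t. L t x) has_real_derivative d1 t x) (at t)" if "t \<in> T" for t x
  proof (cases "x = 0")
    case True
    then show ?thesis by (simp add: L_def zero d1_eq[OF that])
  next
    case False
    then show ?thesis
      unfolding L_def d1_eq[OF that] using q_pos[OF that False]
      by (auto intro!: derivative_eq_intros q_deriv)
  qed
  have d1_deriv: "((\<lambda>t. d1 t x) has_real_derivative d2 t x) (at t)" if t: "t \<in> T" for t x
  proof -
    have "((\<lambda>t. N t x / quad (S t) x) has_real_derivative d2 t x) (at t)"
    proof (cases "x = 0")
      case True
      then show ?thesis by (simp add: zero d2_eq[OF t])
    next
      case False
      have "((\<lambda>t. N t x / quad (S t) x) has_real_derivative
          (N' x * quad (S t) x - N t x * (2 * N t x)) / (quad (S t) x * quad (S t) x)) (at t)"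
        using q_pos[OF t False] by (intro DERIV_divide N_deriv q_deriv) auto
      also have "(N' x * quad (S t) x - N t x * (2 * N t x)) / (quad (S t) x * quad (S t) x) = d2 t x"
        unfolding d2_eq[OF t] using q_pos[OF t False] by (simp add: field_simps power2_eq_square)
      finally show ?thesis .
    qed
    then show ?thesis
      by (rule has_field_derivative_transform_within_open[OF _ openT t]) (simp add: d1_eq)
  qed
  have bound: "\<bar>d1 t x\<bar> \<le> (\<Sum>i\<in>UNIV. \<bar>v $ i\<bar> / m)"
    "\<bar>d2 t x\<bar> \<le> (\<Sum>i\<in>UNIV. (\<bar>v $ i\<bar> / m)\<^sup>2) + 2 * (\<Sum>i\<in>UNIV. \<bar>v $ i\<bar> / m)\<^sup>2"
    if m: "m > 0" "\<And>i. m \<le> S t $ i" for m t x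
  proof -
    have le: "\<bar>v $ i / S t $ i\<bar> \<le> \<bar>v $ i\<bar> / m" for i
      using m(1) m(2)[of i] by (simp add: divide_left_mono)
    have w: "\<bar>weight (S t) i x * c\<bar> \<le> C" if "\<bar>c\<bar> \<le> C" for i c C
      using mult_mono[OF weight_le_1[of "S t" i x] that] weight_nonneg[of "S t" i x] by (simp add: abs_mult)
    have "\<bar>d1 t x\<bar> \<le> (\<Sum>i\<in>UNIV. \<bar>weight (S t) i x * (v $ i / S t $ i)\<bar>)"
      unfolding d1_def by (rule sum_abs)
    also have "\<dots> \<le> (\<Sum>i\<in>UNIV. \<bar>v $ i\<bar> / m)" by (intro sum_mono w le)
    finally show d1: "\<bar>d1 t x\<bar> \<le> (\<Sum>i\<in>UNIV. \<bar>v $ i\<bar> / m)" .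
    have "\<bar>\<Sum>i\<in>UNIV. weight (S t) i x * (v $ i / S t $ i)\<^sup>2\<bar> \<le> (\<Sum>i\<in>UNIV. \<bar>weight (S t) i x * (v $ i / S t $ i)\<^sup>2\<bar>)"
      by (rule sum_abs)
    also have "\<dots> \<le> (\<Sum>i\<in>UNIV. (\<bar>v $ i\<bar> / m)\<^sup>2)"
    proof (intro sum_mono w)
      show "\<bar>(v $ i / S t $ i)\<^sup>2\<bar> \<le> (\<bar>v $ i\<bar> / m)\<^sup>2" for i
        using power_mono[OF le[of i], of 2] by (simp add: power_divide)
    qed
    finally have "\<bar>\<Sum>i\<in>UNIV. weight (S t) i x * (v $ i / S t $ i)\<^sup>2\<bar> \<le> (\<Sum>i\<in>UNIV. (\<bar>v $ i\<bar> / m)\<^sup>2)" .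
    moreover have "(d1 t x)\<^sup>2 \<le> (\<Sum>i\<in>UNIV. \<bar>v $ i\<bar> / m)\<^sup>2" using power_mono[OF d1, of 2] by simp
    moreover have "0 \<le> (d1 t x)\<^sup>2" by simp
    moreover have "d2 t x = (\<Sum>i\<in>UNIV. weight (S t) i x * (v $ i / S t $ i)\<^sup>2) - 2 * (d1 t x)\<^sup>2"
      by (simp add: d2_def d1_def)
    ultimately show "\<bar>d2 t x\<bar> \<le> (\<Sum>i\<in>UNIV. (\<bar>v $ i\<bar> / m)\<^sup>2) + 2 * (\<Sum>i\<in>UNIV. \<bar>v $ i\<bar> / m)\<^sup>2"
      by linarith
  qed
  have EL: "((\<lambda>t. integral\<^sup>L ?M (L t)) has_real_derivative integral\<^sup>L ?M (d1 t0)) (at t0)"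
    and Ed1: "((\<lambda>t. integral\<^sup>L ?M (d1 t)) has_real_derivative integral\<^sup>L ?M (d2 t0)) (at t0)" if "t0 \<in> T" for t0
  proof -
    obtain \<delta> m where \<delta>: "\<delta> > 0" and m: "m > 0" "\<And>t i. t \<in> ball t0 \<delta> \<Longrightarrow> m \<le> S t $ i"
      using local[OF \<open>t0 \<in> T\<close>] by metis
    have T: "t \<in> T" if "t \<in> ball t0 \<delta>" for t
      using m(1) m(2)[OF that] unfolding T_def by (auto intro: less_le_trans)
    show "((\<lambda>t. integral\<^sup>L ?M (L t)) has_real_derivative integral\<^sup>L ?M (d1 t0)) (at t0)"
    proof (rule DERIV_integral_sphere_prob[OF \<delta>])
      show "integrable ?M (L t)" if "t \<in> ball t0 \<delta>" for t
        unfolding L_def by (rule integrable_ln_quad[OF S_ne[OF T[OF that]]])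
    qed (use L_deriv T bound(1)[OF m] in auto)
    show "((\<lambda>t. integral\<^sup>L ?M (d1 t)) has_real_derivative integral\<^sup>L ?M (d2 t0)) (at t0)"
    proof (rule DERIV_integral_sphere_prob[OF \<delta>])
      show "integrable ?M (d1 t)" if "t \<in> ball t0 \<delta>" for t
        by (rule integrable_sphere_prob_bounded) (use bound(1)[OF m(1) m(2)[OF that]] in auto)
    qed (use d1_deriv T bound(2)[OF m] in auto)
  qed
  define \<psi> where "\<psi> t = exp (integral\<^sup>L ?M (L t))" for t
  define \<psi>1 where "\<psi>1 t = \<psi> t * integral\<^sup>L ?M (d1 t)" for t
  have \<psi>_deriv: "(\<psi> has_real_derivative \<psi>1 t) (at t)" if "t \<in> T" for t
    unfolding \<psi>_def \<psi>1_def using EL[OF that] by (auto intro!: derivative_eq_intros)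
  have "convex_on T \<psi>"
  proof (rule f''_ge0_imp_convex[OF convT \<psi>_deriv])
    fix t assume t: "t \<in> T"
    show "(\<psi>1 has_real_derivative \<psi> t * ((integral\<^sup>L ?M (d1 t))\<^sup>2 + integral\<^sup>L ?M (d2 t))) (at t)"
      unfolding \<psi>1_def using \<psi>_deriv[OF t] Ed1[OF t]
      by (auto intro!: derivative_eq_intros simp: \<psi>1_def power2_eq_square algebra_simps)
    have "0 \<le> integral\<^sup>L ?M (d2 t) + (integral\<^sup>L ?M (d1 t))\<^sup>2"
      unfolding d1_def d2_def by (rule second_variation_nonneg) (use t in \<open>simp add: T_def\<close>)
    then show "0 \<le> \<psi> t * ((integral\<^sup>L ?M (d1 t))\<^sup>2 + integral\<^sup>L ?M (d2 t))"
      by (simp add: \<psi>_def)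
  qed
  have S01: "S 0 = s" "S 1 = b" by (simp_all add: S_def v_def)
  have T01: "0 \<in> T" "1 \<in> T" using s b by (simp_all add: T_def S01)
  have "\<psi>1 0 * (1 - 0) \<le> \<psi> 1 - \<psi> 0"
  proof (rule convex_on_imp_above_tangent[OF \<open>convex_on T \<psi>\<close>])
    show "connected T" by (rule convex_connected[OF convT])
    show "0 \<in> interior T" using T01 openT by (simp add: interior_open)
    show "(\<psi> has_real_derivative \<psi>1 0) (at 0 within T)"
      using \<psi>_deriv[OF T01(1)] by (rule has_field_derivative_at_within)
  qed (rule T01)
  moreover have "\<psi> 0 = H0_norm (diag_matrix s)" "\<psi> 1 = H0_norm (diag_matrix b)"
    using S_ne[OF T01(1)] S_ne[OF T01(2)] by (simp_all add: \<psi>_def L_def[abs_def] S01 H0_norm_diag_matrix)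
  moreover have "integral\<^sup>L ?M (d1 0) = (\<Sum>i\<in>UNIV. integral\<^sup>L ?M (weight s i) * (v $ i / s $ i))"
    unfolding d1_def S01 by (simp add: integrable_weight)
  ultimately show ?thesis
    by (simp add: \<psi>1_def H0_grad_def v_def sum_distrib_left mult.assoc)
qed

lemma quad_mono:
  assumes "\<And>i. \<bar>b $ i\<bar> \<le> \<bar>s $ i\<bar>"
  shows "quad b x \<le> quad s x"
  unfolding quad_def
proof (rule sum_mono)
  fix i
  have "\<bar>b $ i * x $ i\<bar> \<le> \<bar>s $ i * x $ i\<bar>" using assms[of i] by (simp add: abs_mult mult_right_mono)
  then show "(b $ i * x $ i)\<^sup>2 \<le> (s $ i * x $ i)\<^sup>2" by (simp add: abs_le_square_iff)
qed

lemma AE_quad_pos: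
  assumes "s \<noteq> 0"
  shows "AE x in sphere_prob. quad s x > 0"
proof -
  have "AE x in sphere_prob. diag_matrix s *v x \<noteq> 0"
    by (rule integrable_sphere_prob_ln_norm(1)) (simp add: assms)
  then show ?thesis
    by eventually_elim (metis norm_diag_matrix_mult norm_eq_zero order_less_le quad_nonneg real_sqrt_zero)
qed

lemma H0_norm_nonneg: "0 \<le> H0_norm A"
  by (cases "A = 0") (simp_all add: H0_norm_zero H0_norm_eq_exp_integral)

lemma H0_norm_diag_matrix_mono:
  assumes "\<And>i. \<bar>b $ i\<bar> \<le> \<bar>s $ i\<bar>"
  shows "H0_norm (diag_matrix b) \<le> H0_norm (diag_matrix s)"
proof (cases "b = 0")
  case True
  then have "diag_matrix b = 0" by simp
  then show ?thesis by (simp only: H0_norm_zero H0_norm_nonneg)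
next
  case False
  have s: "s \<noteq> 0"
  proof
    assume "s = 0"
    then have "b $ i = 0" for i using assms[of i] by simp
    then show False using False by (simp add: vec_eq_iff)
  qed
  have "(\<integral>x. ln (quad b x) / 2 \<partial>sphere_prob) \<le> (\<integral>x. ln (quad s x) / 2 \<partial>sphere_prob)"
  proof (intro integral_mono_AE integrable_ln_quad False s)
    show "AE x in sphere_prob. ln (quad b x) / 2 \<le> ln (quad s x) / 2"
      using AE_quad_pos[OF False]
    proof eventually_elim
      case (elim x)
      then show ?case using quad_mono[OF assms, of x] by (auto intro: ln_mono)
    qed
  qed
  then show ?thesis using False s by (simp add: H0_norm_diag_matrix)
qed

lemma H0_grad_nonneg: "(\<And>i. s $ i > 0) \<Longrightarrow> 0 \<le> H0_grad s i"
  unfolding H0_grad_def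
  by (intro divide_nonneg_pos mult_nonneg_nonneg H0_norm_nonneg integral_nonneg_AE AE_I2 weight_nonneg)

text \<open>Euler's identity for a function homogeneous of degree 1; it makes the supporting
  hyperplane pass through the origin.\<close>

lemma sum_H0_grad:
  assumes "\<And>i. s $ i > 0"
  shows "(\<Sum>i\<in>UNIV. H0_grad s i * s $ i) = H0_norm (diag_matrix s)"
proof -
  have "H0_grad s i * s $ i = H0_norm (diag_matrix s) * integral\<^sup>L sphere_prob (weight s i)" for i
    using assms[of i] by (simp add: H0_grad_def)
  then show ?thesis by (simp add: sum_integral_weight[OF assms] flip: sum_distrib_left)
qed

text \<open>Since the gradient is nonnegative, \<open>b\<close> may be replaced by the larger
  positive vector \<open>B m\<close>, to which the positive case and Euler's identity apply. Letting
  \<open>m\<close> grow recovers the norm at \<open>b\<close>, which depends only on the absolute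
  values of its entries.\<close>

lemma H0_grad_supporting:
  fixes s b :: "real^'n"
  assumes s: "\<And>i. s $ i > 0"
  shows "(\<Sum>i\<in>UNIV. H0_grad s i * b $ i) \<le> H0_norm (diag_matrix b)"
proof (cases "b = 0")
  case True
  then show ?thesis by (simp add: H0_norm_nonneg)
next
  case False
  let ?M = "sphere_prob :: (real^'n) measure"
  define B where "B m = (\<chi> i. \<bar>b $ i\<bar> + 1 / (real m + 1))" for m
  have B_pos: "B m $ i > 0" for m i by (simp add: B_def add_nonneg_pos)
  then have B_ne: "B m \<noteq> 0" for m by (metis less_irrefl zero_index)
  have le: "\<bar>b $ i\<bar> \<le> \<bar>B m $ i\<bar>" "\<bar>B m $ i\<bar> \<le> \<bar>B 0 $ i\<bar>" for m i
    by (simp_all add: B_def divide_le_eq)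
  have lim: "(\<lambda>m. quad (B m) x) \<longlonglongrightarrow> quad b x" for x
  proof -
    have "(\<lambda>m. (\<bar>b $ i\<bar> + 1 / (real m + 1)) * x $ i) \<longlonglongrightarrow> (\<bar>b $ i\<bar> + 0) * x $ i" for i
      using LIMSEQ_inverse_real_of_nat by (intro tendsto_intros) (simp add: inverse_eq_divide add.commute)
    then have "(\<lambda>m. quad (B m) x) \<longlonglongrightarrow> (\<Sum>i\<in>UNIV. ((\<bar>b $ i\<bar> + 0) * x $ i)\<^sup>2)"
      unfolding quad_def B_def by (simp only: vec_lambda_beta) (intro tendsto_sum tendsto_power)
    then show ?thesis by (simp add: quad_def power_mult_distrib)
  qed
  \<comment> \<open>\<open>quad (B m) x\<close> lies between \<open>quad b x\<close> and
    \<open>quad (B 0) x\<close>, so the logarithms at these two ends dominate the sequence.\<close>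
  have "(\<lambda>m. \<integral>x. ln (quad (B m) x) / 2 \<partial>?M) \<longlonglongrightarrow> (\<integral>x. ln (quad b x) / 2 \<partial>?M)"
  proof (rule integral_dominated_convergence[where w = "\<lambda>x. \<bar>ln (quad b x) / 2\<bar> + \<bar>ln (quad (B 0) x) / 2\<bar>"])
    show "integrable ?M (\<lambda>x. \<bar>ln (quad b x) / 2\<bar> + \<bar>ln (quad (B 0) x) / 2\<bar>)"
      by (intro Bochner_Integration.integrable_add integrable_abs integrable_ln_quad False B_ne)
    show "AE x in ?M. (\<lambda>m. ln (quad (B m) x) / 2) \<longlonglongrightarrow> ln (quad b x) / 2"
      using AE_quad_pos[OF False] by eventually_elim (auto intro!: tendsto_intros lim)
    show "AE x in ?M. norm (ln (quad (B m) x) / 2) \<le> \<bar>ln (quad b x) / 2\<bar> + \<bar>ln (quad (B 0) x) / 2\<bar>" for m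
      using AE_quad_pos[OF False]
    proof eventually_elim
      case (elim x)
      have "quad b x \<le> quad (B m) x" "quad (B m) x \<le> quad (B 0) x" using le by (auto intro: quad_mono)
      then have "ln (quad b x) \<le> ln (quad (B m) x)" "ln (quad (B m) x) \<le> ln (quad (B 0) x)"
        using elim by (auto intro!: ln_mono)
      then show ?case by (auto simp: abs_if)
    qed
  qed (intro borel_measurable_integrable integrable_ln_quad False B_ne)+
  then have "(\<lambda>m. H0_norm (diag_matrix (B m))) \<longlonglongrightarrow> H0_norm (diag_matrix b)"
    unfolding H0_norm_diag_matrix[OF B_ne] H0_norm_diag_matrix[OF False] by (rule tendsto_exp)
  moreover have "(\<Sum>i\<in>UNIV. H0_grad s i * b $ i) \<le> H0_norm (diag_matrix (B m))" for m
  proof -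
    have "(\<Sum>i\<in>UNIV. H0_grad s i * b $ i) \<le> (\<Sum>i\<in>UNIV. H0_grad s i * B m $ i)"
    proof (intro sum_mono mult_left_mono H0_grad_nonneg s)
      show "b $ i \<le> B m $ i" for i using le(1)[of i m] B_pos[of m i] by linarith
    qed
    also have "\<dots> \<le> H0_norm (diag_matrix (B m))"
      using H0_grad_supporting_pos[OF s B_pos, of m] sum_H0_grad[OF s]
      by (simp add: right_diff_distrib sum_subtractf)
    finally show ?thesis .
  qed
  ultimately show ?thesis by (intro LIMSEQ_le_const) auto
qed

subsection \<open>Weighted traces and the singular value decomposition\<close>

text \<open>The trace of \<open>diag_matrix w ** C\<close>.\<close>

definition weighted_trace :: "real^'n \<Rightarrow> real^'n^'n \<Rightarrow> real" where
  "weighted_trace w C = (\<Sum>k\<in>UNIV. w $ k * C $ k $ k)"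

lemma matrix_mult_component: "(A ** B) $ k $ l = (A *v (\<chi> m. B $ m $ l)) $ k"
  by (simp add: matrix_matrix_mult_def matrix_vector_mult_def)

lemma weighted_trace_givens:
  assumes "i \<noteq> j"
  shows "weighted_trace w (givens i j a b ** C) = a * (w $ i * C $ i $ i + w $ j * C $ j $ j)
    + b * (w $ j * C $ i $ j - w $ i * C $ j $ i) + (\<Sum>k\<in>UNIV - {i, j}. w $ k * C $ k $ k)"
proof -
  have "(\<Sum>k\<in>UNIV - {i, j}. w $ k * (givens i j a b ** C) $ k $ k) = (\<Sum>k\<in>UNIV - {i, j}. w $ k * C $ k $ k)"
    by (rule sum.cong) (auto simp: matrix_mult_component givens_mult_component[OF assms])
  then show ?thesis
    using assms unfolding weighted_trace_def sum_UNIV_remove2[OF assms]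
    by (simp add: matrix_mult_component givens_mult_component algebra_simps)
qed

text \<open>Rotating in the plane \<open>(i, j)\<close> gives \<open>a * X + b * Y\<close> plus a
  constant, with maximum \<open>sqrt (X\<^sup>2 + Y\<^sup>2)\<close> plus that constant on the unit
  circle. Since \<open>a = 1\<close>, \<open>b = 0\<close> is already optimal, \<open>Y\<close> must
  vanish; no derivative is taken.\<close>

lemma weighted_trace_maximal_symmetric:
  assumes max: "\<And>U. orthogonal_matrix U \<Longrightarrow> weighted_trace w (U ** C) \<le> weighted_trace w C"
    and ij: "i \<noteq> j"
  shows "w $ j * C $ i $ j = w $ i * C $ j $ i"
proof -
  define X where "X = w $ i * C $ i $ i + w $ j * C $ j $ j"
  define Y where "Y = w $ j * C $ i $ j - w $ i * C $ j $ i"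
  have le: "a * X + b * Y \<le> X" if "a\<^sup>2 + b\<^sup>2 = 1" for a b
  proof -
    have "weighted_trace w C = X + (\<Sum>k\<in>UNIV - {i, j}. w $ k * C $ k $ k)"
      unfolding weighted_trace_def sum_UNIV_remove2[OF ij] X_def by simp
    then show ?thesis
      using max[OF orthogonal_matrix_givens[OF ij that]] weighted_trace_givens[OF ij, of w a b C]
      by (simp add: X_def Y_def)
  qed
  define r where "r = sqrt (X\<^sup>2 + Y\<^sup>2)"
  have r2: "r\<^sup>2 = X\<^sup>2 + Y\<^sup>2" "r \<ge> 0" by (simp_all add: r_def)
  have "Y = 0"
  proof (cases "r = 0")
    case True
    then show ?thesis using r2 by (simp add: sum_power2_eq_zero_iff)
  next
    case False
    then have r: "r > 0" using r2 by simp
    have "(X / r)\<^sup>2 + (Y / r)\<^sup>2 = r\<^sup>2 / r\<^sup>2"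
      unfolding r2(1) by (simp only: power_divide add_divide_distrib r2(1))
    then have "(X / r)\<^sup>2 + (Y / r)\<^sup>2 = 1" using r by simp
    then have "X / r * X + Y / r * Y \<le> X" by (rule le)
    moreover have "X / r * X + Y / r * Y = r\<^sup>2 / r"
      unfolding r2(1) by (simp add: power2_eq_square add_divide_distrib)
    ultimately have "r \<le> X" using r by (simp add: power2_eq_square)
    then have "r\<^sup>2 \<le> X\<^sup>2" using r by (intro power_mono) auto
    then show ?thesis using r2 by simp
  qed
  then show ?thesis by (simp add: Y_def)
qed

lemma compact_orthogonal_matrices: "compact {U :: real^'n^'n. orthogonal_matrix U}"
proof -
  have "{U :: real^'n^'n. orthogonal_matrix U} =
      {U. \<forall>i j. (\<Sum>k\<in>UNIV. U $ k $ i * U $ k $ j) = (if i = j then 1 else 0)}"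
    by (auto simp: orthogonal_matrix vec_eq_iff matrix_matrix_mult_def transpose_def mat_def)
  moreover have "closed {U :: real^'n^'n. \<forall>i j. (\<Sum>k\<in>UNIV. U $ k $ i * U $ k $ j) = (if i = j then 1 else 0)}"
    by (intro closed_Collect_all closed_Collect_eq continuous_intros)
  moreover have "bounded {U :: real^'n^'n. orthogonal_matrix U}"
  proof (rule boundedI)
    fix U :: "real^'n^'n" assume "U \<in> {U. orthogonal_matrix U}"
    then have "norm (U $ i) = 1" for i
      by (simp add: orthogonal_matrix_orthonormal_rows row_def vec_lambda_eta)
    then show "norm U \<le> real CARD('n)"
      unfolding norm_vec_def[of U] using L2_set_le_sum[of UNIV "\<lambda>i. norm (U $ i)"] by simp
  qed
  ultimately show ?thesis by (simp add: compact_eq_bounded_closed)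
qed

text \<open>
  Maximizing \<open>weighted_trace w (U ** B ** V)\<close> over orthogonal \<open>U\<close>, \<open>V\<close> yields a singular value
  decomposition of \<open>B\<close> together with von Neumann's trace inequality: the first-order condition for
  plane rotations on the left and on the right gives \<open>w\<^sub>j\<^sup>2 C\<^sub>i\<^sub>j = w\<^sub>i\<^sup>2 C\<^sub>i\<^sub>j\<close> at a maximizer \<open>C\<close>.
\<close>

lemma diagonalization_weighted_trace:
  fixes w :: "real^'n" and B :: "real^'n^'n"
  assumes pos: "\<And>i. w $ i > 0" and distinct: "\<And>i j. i \<noteq> j \<Longrightarrow> w $ i \<noteq> w $ j"
  obtains U V c where "orthogonal_matrix U" "orthogonal_matrix V" "U ** B ** V = diag_matrix c"
    "weighted_trace w B \<le> (\<Sum>i\<in>UNIV. w $ i * c $ i)"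
proof -
  let ?O = "{U :: real^'n^'n. orthogonal_matrix U}"
  have one: "mat 1 \<in> ?O" by (simp add: orthogonal_matrix_id)
  have "continuous_on (?O \<times> ?O) (\<lambda>p. weighted_trace w (fst p ** B ** snd p))"
    unfolding weighted_trace_def matrix_matrix_mult_def
    by (simp only: vec_lambda_beta) (intro continuous_intros)
  then obtain p where p: "p \<in> ?O \<times> ?O"
      and max: "\<And>q. q \<in> ?O \<times> ?O \<Longrightarrow> weighted_trace w (fst q ** B ** snd q) \<le> weighted_trace w (fst p ** B ** snd p)"
    using continuous_attains_sup[of "?O \<times> ?O"] compact_Times[OF compact_orthogonal_matrices compact_orthogonal_matrices] one
    by blast
  obtain U V where "p = (U, V)" by force
  then have U: "orthogonal_matrix U" and V: "orthogonal_matrix V" using p by auto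
  define C where "C = U ** B ** V"
  have maxC: "weighted_trace w (U' ** B ** V') \<le> weighted_trace w C"
    if "orthogonal_matrix U'" "orthogonal_matrix V'" for U' V'
    using max[of "(U', V')"] that by (simp add: C_def \<open>p = (U, V)\<close>)
  have "C $ i $ j = 0" if ij: "i \<noteq> j" for i j
  proof -
    have "w $ j * C $ i $ j = w $ i * C $ j $ i"
    proof (rule weighted_trace_maximal_symmetric[OF _ ij])
      fix Q :: "real^'n^'n" assume "orthogonal_matrix Q"
      then show "weighted_trace w (Q ** C) \<le> weighted_trace w C"
        using maxC[OF orthogonal_matrix_mul[OF _ U] V] by (simp add: C_def matrix_mul_assoc)
    qed
    \<comment> \<open>Rotations on the right are rotations of the transpose on the left, and
      transposing preserves the weighted trace.\<close>
    moreover have "w $ j * transpose C $ i $ j = w $ i * transpose C $ j $ i"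
    proof (rule weighted_trace_maximal_symmetric[OF _ ij])
      fix Q :: "real^'n^'n" assume Q: "orthogonal_matrix Q"
      have tr: "weighted_trace w (transpose X) = weighted_trace w X" for X
        by (simp add: weighted_trace_def transpose_def)
      have "Q ** transpose C = transpose (U ** B ** (V ** transpose Q))"
        by (simp add: C_def matrix_transpose_mul matrix_mul_assoc)
      then show "weighted_trace w (Q ** transpose C) \<le> weighted_trace w (transpose C)"
        using maxC[OF U orthogonal_matrix_mul[OF V]] Q by (simp add: tr)
    qed
    ultimately have "w $ j * (w $ j * C $ i $ j) = w $ i * (w $ i * C $ i $ j)"
      by (simp add: transpose_def)
    then have "((w $ j)\<^sup>2 - (w $ i)\<^sup>2) * C $ i $ j = 0"
      by (simp add: power2_eq_square algebra_simps)
    moreover have "(w $ j)\<^sup>2 \<noteq> (w $ i)\<^sup>2"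
      using distinct[OF ij] pos[of i] pos[of j] by (auto simp: power2_eq_iff)
    ultimately show ?thesis by simp
  qed
  then have "U ** B ** V = diag_matrix (\<chi> i. C $ i $ i)"
    by (simp add: diag_matrix_def vec_eq_iff flip: C_def)
  moreover have "weighted_trace w B \<le> (\<Sum>i\<in>UNIV. w $ i * (\<chi> i. C $ i $ i) $ i)"
    using maxC[of "mat 1" "mat 1"] one by (simp add: weighted_trace_def)
  ultimately show ?thesis using that U V by blast
qed

lemma orthogonal_matrix_norm_mult:
  "orthogonal_matrix U \<Longrightarrow> norm (U *v x) = norm (x :: real^'n)"
  using orthogonal_transformation_norm[of "(*v) U" x] by (simp add: orthogonal_transformation_matrix)

text \<open>The left factor preserves the Euclidean norm inside the logarithm, the right factor
  preserves the measure.\<close>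

lemma H0_norm_orthogonal:
  fixes A :: "real^'n^'n"
  assumes U: "orthogonal_matrix U" and V: "orthogonal_matrix V"
  shows "H0_norm (U ** A ** V) = H0_norm A"
proof (cases "A = 0")
  case True
  then show ?thesis by simp
next
  case False
  have "transpose U ** (U ** A ** V) ** transpose V = (transpose U ** U) ** A ** (V ** transpose V)"
    by (simp only: matrix_mul_assoc)
  also have "\<dots> = A" using U V by (simp add: orthogonal_matrix_def)
  finally have "U ** A ** V \<noteq> 0" using False by auto
  moreover have "norm (U ** A ** V *v x) = norm (A *v (V *v x))" for x
    by (simp add: orthogonal_matrix_norm_mult[OF U] flip: matrix_vector_mul_assoc)
  moreover have "(\<integral>x. ln (norm (A *v (V *v x))) \<partial>sphere_prob) = (\<integral>x. ln (norm (A *v x)) \<partial>sphere_prob)"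
    using V by (intro integral_sphere_prob_orthogonal[where h = "\<lambda>x. ln (norm (A *v x))"])
      (simp_all add: orthogonal_transformation_matrix)
  ultimately show ?thesis using False by (simp add: H0_norm_eq_exp_integral)
qed

lemma exists_positive_distinct: "\<exists>e :: 'n::finite \<Rightarrow> real. inj e \<and> (\<forall>i. e i > 0)"
proof -
  obtain f :: "'n \<Rightarrow> nat" where "inj f" using finite_imp_inj_to_nat_seg[of "UNIV :: 'n set"] by auto
  then show ?thesis by (intro exI[of _ "\<lambda>i. real (f i) + 1"]) (auto simp: inj_def)
qed

text \<open>For positive distinct weights, diagonalizing \<open>B\<close> to \<open>c\<close> bounds
  the trace by the sum of \<open>w $ i * c $ i\<close>, hence by
  \<open>H0_norm (diag_matrix c) = H0_norm B\<close>. Other weights are perturbed to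
  \<open>w + \<epsilon> e\<close> at a cost of at most \<open>\<epsilon> * M\<close>.\<close>

lemma weighted_trace_le_H0_norm:
  fixes w :: "real^'n" and B :: "real^'n^'n"
  assumes w: "\<And>i. w $ i \<ge> 0" and diag: "\<And>c. (\<Sum>i\<in>UNIV. w $ i * c $ i) \<le> H0_norm (diag_matrix c)"
  shows "weighted_trace w B \<le> H0_norm B"
proof (rule field_le_epsilon)
  fix \<delta> :: real assume \<delta>: "\<delta> > 0"
  obtain e :: "'n \<Rightarrow> real" where e: "inj e" "\<And>i. e i > 0" using exists_positive_distinct by metis
  \<comment> \<open>The diagonal \<open>c\<close> found below depends on \<epsilon>, but its entries
    never exceed the operator norm \<open>K\<close>; hence \<open>M\<close> can be fixed before
    \<epsilon>.\<close>
  define K where "K = onorm ((*v) B)"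
  define M where "M = (\<Sum>i\<in>UNIV. e i * (K + \<bar>B $ i $ i\<bar>))"
  have K: "K \<ge> 0" unfolding K_def by (intro onorm_pos_le) (simp add: linear_linear)
  have M: "M \<ge> 0" unfolding M_def using e K by (intro sum_nonneg mult_nonneg_nonneg) (auto intro: less_imp_le)
  \<comment> \<open>Each pair of distinct indices excludes one value of \<epsilon>, the one at which
    their perturbed weights coincide, so the interval contains an admissible one.\<close>
  have "infinite {0<..<\<delta> / (M + 1)}" using \<delta> M by (simp add: infinite_Ioo)
  moreover have "finite (range (\<lambda>(i, j). (w $ j - w $ i) / (e i - e j)))" by simp
  ultimately obtain \<epsilon> where \<epsilon>: "0 < \<epsilon>" "\<epsilon> < \<delta> / (M + 1)"
      and generic: "\<epsilon> \<notin> range (\<lambda>(i, j). (w $ j - w $ i) / (e i - e j))"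
    by (metis (no_types, lifting) finite_subset greaterThanLessThan_iff subsetI)
  define w' where "w' = (\<chi> i. w $ i + \<epsilon> * e i)"
  obtain U V c where U: "orthogonal_matrix U" and V: "orthogonal_matrix V"
    and C: "U ** B ** V = diag_matrix c" and le: "weighted_trace w' B \<le> (\<Sum>i\<in>UNIV. w' $ i * c $ i)"
  proof (rule diagonalization_weighted_trace[of w' B])
    show "w' $ i > 0" for i using w[of i] e(2)[of i] \<epsilon> by (simp add: w'_def add_nonneg_pos)
    show "w' $ i \<noteq> w' $ j" if "i \<noteq> j" for i j
    proof
      assume "w' $ i = w' $ j"
      then have "\<epsilon> * (e i - e j) = w $ j - w $ i" by (simp add: w'_def algebra_simps)
      moreover have "e i - e j \<noteq> 0" using e(1) that by (auto dest: injD)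
      ultimately have "\<epsilon> = (w $ j - w $ i) / (e i - e j)" by (simp add: field_simps)
      then show False using generic by (auto simp: image_iff)
    qed
  qed
  have c: "c $ i \<le> K" for i
  proof -
    have "c $ i = (diag_matrix c *v axis i 1) $ i" by (simp add: diag_matrix_mult_component axis_def)
    also have "\<dots> \<le> norm (diag_matrix c *v axis i 1)"
      using component_le_norm_cart[of "diag_matrix c *v axis i 1" i] by linarith
    also have "\<dots> = norm (B *v (V *v axis i 1))"
      by (simp add: orthogonal_matrix_norm_mult[OF U] flip: C matrix_vector_mul_assoc)
    also have "\<dots> \<le> K * norm (V *v axis i 1)" unfolding K_def by (rule onorm) simp
    also have "\<dots> = K" by (simp add: orthogonal_matrix_norm_mult[OF V])
    finally show ?thesis .
  qed
  have "weighted_trace w B = weighted_trace w' B + \<epsilon> * (\<Sum>i\<in>UNIV. e i * - B $ i $ i)"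
    by (simp add: weighted_trace_def w'_def sum_distrib_left algebra_simps sum.distrib sum_negf)
  also have "\<dots> \<le> (\<Sum>i\<in>UNIV. w' $ i * c $ i) + \<epsilon> * (\<Sum>i\<in>UNIV. e i * - B $ i $ i)"
    using le by simp
  also have "\<dots> = (\<Sum>i\<in>UNIV. w $ i * c $ i) + \<epsilon> * (\<Sum>i\<in>UNIV. e i * (c $ i + - B $ i $ i))"
    by (simp add: w'_def sum_distrib_left algebra_simps sum.distrib sum_subtractf sum_negf)
  also have "\<dots> \<le> H0_norm B + \<epsilon> * M"
  proof (intro add_mono mult_left_mono)
    show "(\<Sum>i\<in>UNIV. w $ i * c $ i) \<le> H0_norm B" using diag[of c] by (simp flip: C add: H0_norm_orthogonal U V)
    show "(\<Sum>i\<in>UNIV. e i * (c $ i + - B $ i $ i)) \<le> M"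
      unfolding M_def using e(2) c by (intro sum_mono mult_left_mono add_mono) (auto intro: less_imp_le)
  qed (use \<epsilon> in simp)
  also have "\<epsilon> * M \<le> \<delta>"
  proof -
    have "\<epsilon> * M \<le> \<epsilon> * (M + 1)" using \<epsilon> by simp
    also have "\<dots> \<le> \<delta>" using \<epsilon> M by (simp add: field_simps)
    finally show ?thesis .
  qed
  finally show "weighted_trace w B \<le> H0_norm B + \<delta>" by simp
qed

subsection \<open>The triangle inequality\<close>

lemma matrix_add_rdistrib: "(A + B) ** C = A ** C + B ** (C :: real^'n^'n)"
  by (simp add: matrix_matrix_mult_def vec_eq_iff distrib_right sum.distrib)

lemma weighted_trace_add: "weighted_trace w (A + B) = weighted_trace w A + weighted_trace w B"
  by (simp add: weighted_trace_def distrib_left sum.distrib)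

text \<open>By Euler's identity, the gradient at \<open>s\<close> is a linear functional that
  attains the norm at \<open>diag_matrix s\<close>. It splits over \<open>A + B\<close>, and on each
  summand it is bounded by the norm, which is unchanged by the orthogonal factors.\<close>

lemma H0_norm_triangle:
  fixes A B :: "real^'n^'n"
  shows "H0_norm (A + B) \<le> H0_norm A + H0_norm B"
proof (rule field_le_epsilon)
  fix \<delta> :: real assume \<delta>: "\<delta> > 0"
  obtain e :: "'n \<Rightarrow> real" where e: "inj e" "\<And>i. e i > 0" using exists_positive_distinct by metis
  obtain U V c where U: "orthogonal_matrix U" and V: "orthogonal_matrix V"
    and C: "U ** (A + B) ** V = diag_matrix c"
    by (rule diagonalization_weighted_trace[of "\<chi> i. e i" "A + B"]) (use e in \<open>auto dest: injD\<close>)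
  \<comment> \<open>The diagonalization leaves the signs of \<open>c\<close> open; \<open>D\<close>
    flips the negative ones, as the gradient is available only at positive vectors.\<close>
  define D :: "real^'n^'n" where "D = diag_matrix (\<chi> i. if c $ i < 0 then - 1 else 1)"
  have D_mult: "(D ** X) $ i $ j = (if c $ i < 0 then - X $ i $ j else X $ i $ j)" for X :: "real^'n^'n" and i j
    by (simp add: D_def matrix_mult_component diag_matrix_mult_component)
  have D: "orthogonal_matrix D"
  proof -
    have "transpose D = D" by (auto simp: vec_eq_iff transpose_def D_def diag_matrix_def)
    moreover have "D ** D = mat 1"
      by (simp add: vec_eq_iff D_mult) (auto simp: D_def diag_matrix_def mat_def)
    ultimately show ?thesis by (simp add: orthogonal_matrix)
  qed
  have DU: "orthogonal_matrix (D ** U)" using D U by (rule orthogonal_matrix_mul)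
  have abs_c: "D ** U ** (A + B) ** V = diag_matrix (\<chi> i. \<bar>c $ i\<bar>)"
    using C by (simp add: vec_eq_iff D_mult diag_matrix_def flip: matrix_mul_assoc)
  let ?K = "H0_norm (diag_matrix (1 :: real^'n))"
  define \<epsilon> where "\<epsilon> = \<delta> / (?K + 1)"
  have K: "?K \<ge> 0" by (rule H0_norm_nonneg)
  then have \<epsilon>: "\<epsilon> > 0" "\<epsilon> * ?K \<le> \<delta>" using \<delta> by (simp_all add: \<epsilon>_def field_simps)
  \<comment> \<open>The shift keeps \<open>s\<close> positive even if \<open>A + B\<close> is
    singular. It costs \<epsilon> times the functional at the identity matrix
    \<open>diag_matrix 1\<close>, hence at most \<open>\<epsilon> * ?K\<close>.\<close>
  define s where "s = (\<chi> i. \<bar>c $ i\<bar> + \<epsilon>)"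
  have s: "s $ i > 0" for i using \<epsilon> by (simp add: s_def add_nonneg_pos)
  define w where "w = (\<chi> i. H0_grad s i)"
  have w: "weighted_trace w X \<le> H0_norm X" for X
    by (rule weighted_trace_le_H0_norm) (auto simp: w_def H0_grad_nonneg[OF s] H0_grad_supporting[OF s])
  have "H0_norm (A + B) = H0_norm (diag_matrix (\<chi> i. \<bar>c $ i\<bar>))"
    unfolding abs_c[symmetric] by (rule H0_norm_orthogonal[OF DU V, symmetric])
  also have "\<dots> \<le> H0_norm (diag_matrix s)"
    using \<epsilon> by (intro H0_norm_diag_matrix_mono) (simp add: s_def)
  also have "\<dots> = weighted_trace w (D ** U ** (A + B) ** V) + \<epsilon> * weighted_trace w (diag_matrix 1)"
    unfolding sum_H0_grad[OF s, symmetric] abs_c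
    by (simp add: weighted_trace_def w_def s_def diag_matrix_def distrib_left distrib_right sum.distrib sum_distrib_left mult.commute)
  also have "weighted_trace w (D ** U ** (A + B) ** V) =
      weighted_trace w (D ** U ** A ** V) + weighted_trace w (D ** U ** B ** V)"
    by (simp add: matrix_add_ldistrib matrix_add_rdistrib weighted_trace_add)
  also have "\<dots> \<le> H0_norm A + H0_norm B"
    using w[of "D ** U ** A ** V"] w[of "D ** U ** B ** V"] by (simp add: H0_norm_orthogonal[OF DU V])
  also have "\<epsilon> * weighted_trace w (diag_matrix 1) \<le> \<epsilon> * ?K"
    using w \<epsilon> by (intro mult_left_mono) auto
  also have "\<dots> \<le> \<delta>" by (rule \<epsilon>(2))
  finally show "H0_norm (A + B) \<le> H0_norm A + H0_norm B + \<delta>" by simp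
qed

lemma H0_norm_eq_0_iff: "H0_norm A = 0 \<longleftrightarrow> A = 0"
  by (cases "A = 0") (simp_all add: H0_norm_zero H0_norm_eq_exp_integral)

lemma H0_norm_scaleR:
  fixes A :: "real^'n^'n"
  shows "H0_norm (a *\<^sub>R A) = \<bar>a\<bar> * H0_norm A"
proof (cases "a = 0 \<or> A = 0")
  case True
  then show ?thesis by (auto simp: H0_norm_zero)
next
  case False
  let ?M = "sphere_prob :: (real^'n) measure"
  have "(\<integral>x. ln (norm (a *\<^sub>R A *v x)) \<partial>?M) = (\<integral>x. ln \<bar>a\<bar> + ln (norm (A *v x)) \<partial>?M)"
  proof (rule integral_cong_AE)
    show "AE x in ?M. ln (norm (a *\<^sub>R A *v x)) = ln \<bar>a\<bar> + ln (norm (A *v x))"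
    proof (rule eventually_mono)
      show "AE x in ?M. A *v x \<noteq> 0" using False by (intro integrable_sphere_prob_ln_norm(1)) auto
      fix x assume "A *v x \<noteq> 0"
      then show "ln (norm (a *\<^sub>R A *v x)) = ln \<bar>a\<bar> + ln (norm (A *v x))"
        using False by (simp add: ln_mult flip: scaleR_matrix_vector_assoc)
    qed
  qed (use False in \<open>auto intro!: borel_measurable_integrable Bochner_Integration.integrable_add
      finite_measure.integrable_const[OF finite_measure_sphere_prob] integrable_sphere_prob_ln_norm(2)\<close>)
  also have "\<dots> = ln \<bar>a\<bar> + (\<integral>x. ln (norm (A *v x)) \<partial>?M)"
    using integrable_sphere_prob_ln_norm(2)[of A] False
      finite_measure.integrable_const[OF finite_measure_sphere_prob, of "ln \<bar>a\<bar>"]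
    by (subst Bochner_Integration.integral_add) auto
  finally show ?thesis using False by (simp add: H0_norm_eq_exp_integral exp_add)
qed

theorem theorem3p1:
  assumes "CARD('n::finite) \<ge> 2"
  shows "is_norm (H0_norm :: real ^ 'n ^ 'n \<Rightarrow> real)
    \<and> orthogonally_invariant (H0_norm :: real ^ 'n ^ 'n \<Rightarrow> real)"
  unfolding is_norm_def orthogonally_invariant_def
  by (simp add: H0_norm_nonneg H0_norm_eq_0_iff H0_norm_scaleR H0_norm_triangle H0_norm_orthogonal)

end
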